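(* Let $H\in(0,1/2)$, $T>0$, let $B^H$ be a fractional Brownian motion with Hurst index $H$, and let $f\in C^{(1)}([0,T])$ (continuously differentiable). Then $$\int_0^Tf(t)\,dB^H(t)=B^H(T)f(T)-\int_0^TB^H(t)\,df(t)$$ almost surely, where the left-hand side is the Wiener integral with respect to $B^H$ and $\int_0^TB^H(t)\,df(t)$ is the pathwise Riemann integral.
   Context: A fractional Brownian motion with Hurst index $H$ is a centered Gaussian process (with continuous paths) with covariance $\frac12(t^{2H}+s^{2H}-|t-s|^{2H})$. Let $C_1=\left(\frac{2H\Gamma(H+1/2)\Gamma(3/2-H)}{\Gamma(2-2H)}\right)^{1/2}$. Define $$(K^H_T\varphi)(t)=-\frac{C_1t^{1/2-H}}{\Gamma(H+1/2)}\frac{d}{dt}\int_t^T(u-t)^{H-1/2}u^{H-1/2}\varphi(u)\,du,$$ $$(K^{H,*}_T\varphi)(t)=\frac{C_1^{-1}t^{1/2-H}}{\Gamma(1/2-H)}\int_t^T(u-t)^{-1/2-H}u^{H-1/2}\varphi(u)\,du,$$ so that $K^H_TK^{H,*}_T\varphi=\varphi$ for $\varphi\in L_2([0,T])$. The underlying Wiener process $B$ of $B^H$ is the Wiener process such that $B^H(t)=\int_0^t(K^H_T\mathbf 1_{[0,t]})(s)\,dB(s)$ (it exists and is determined by $B^H$). For $f$ in the class $\{f:\ f=K^{H,*}_T\varphi\text{ for some }\varphi\in L_2([0,T])\}$, the Wiener integral with respect to $B^H$ is defined as $\int_0^Tf(t)\,dB^H(t)=\int_0^T(K^H_Tf)(t)\,dB(t)$.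 *)

theory Defs
  imports "HOL-Probability.Probability"
begin

section \<open>Gaussian processes, Wiener process, fractional Brownian motion\<close>

text \<open>Constants count as (degenerate) Gaussian random variables.\<close>

definition gaussian_rv :: "'a measure \<Rightarrow> ('a \<Rightarrow> real) \<Rightarrow> bool" where
  "gaussian_rv M Y \<longleftrightarrow> Y \<in> borel_measurable M \<and>
     ((\<exists>\<mu>. AE \<omega> in M. Y \<omega> = \<mu>) \<or>
      (\<exists>\<mu> \<sigma>. \<sigma> > 0 \<and> distributed M lborel Y (\<lambda>x. ennreal (normal_density \<mu> \<sigma> x))))"

definition centered_gaussian_process ::
    "'a measure \<Rightarrow> real set \<Rightarrow> (real \<Rightarrow> 'a \<Rightarrow> real) \<Rightarrow> (real \<Rightarrow> real \<Rightarrow> real) \<Rightarrow> bool" where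
  "centered_gaussian_process M I X R \<longleftrightarrow> prob_space M \<and>
     (\<forall>J c. finite J \<and> J \<subseteq> I \<longrightarrow> gaussian_rv M (\<lambda>\<omega>. \<Sum>t\<in>J. c t * X t \<omega>)) \<and>
     (\<forall>t\<in>I. integral\<^sup>L M (X t) = 0) \<and>
     (\<forall>s\<in>I. \<forall>t\<in>I. integral\<^sup>L M (\<lambda>\<omega>. X s \<omega> * X t \<omega>) = R s t)"

text \<open>
  Path continuity is only required almost surely, which covers both the convention
  that all paths are continuous and the convention that almost all of them are.
\<close>

definition continuous_paths :: "'a measure \<Rightarrow> real set \<Rightarrow> (real \<Rightarrow> 'a \<Rightarrow> real) \<Rightarrow> bool" where
  "continuous_paths M I X \<longleftrightarrow> (AE \<omega> in M. continuous_on I (\<lambda>t. X t \<omega>))"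

definition wiener_process :: "'a measure \<Rightarrow> real set \<Rightarrow> (real \<Rightarrow> 'a \<Rightarrow> real) \<Rightarrow> bool" where
  "wiener_process M I B \<longleftrightarrow>
     centered_gaussian_process M I B min \<and> continuous_paths M I B"

definition fractional_brownian_motion ::
    "'a measure \<Rightarrow> real \<Rightarrow> real set \<Rightarrow> (real \<Rightarrow> 'a \<Rightarrow> real) \<Rightarrow> bool" where
  "fractional_brownian_motion M H I X \<longleftrightarrow>
     centered_gaussian_process M I X
       (\<lambda>s t. (t powr (2 * H) + s powr (2 * H) - \<bar>t - s\<bar> powr (2 * H)) / 2) \<and>
     continuous_paths M I X"

section \<open>The Wiener integral with respect to a Wiener process\<close>

definition L2_fun :: "'a measure \<Rightarrow> ('a \<Rightarrow> real) \<Rightarrow> bool" where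
  "L2_fun N g \<longleftrightarrow> g \<in> borel_measurable N \<and> integrable N (\<lambda>x. (g x)\<^sup>2)"

definition partition_points :: "real \<Rightarrow> nat \<Rightarrow> (nat \<Rightarrow> real) \<Rightarrow> bool" where
  "partition_points T n t \<longleftrightarrow> mono_on {..n} t \<and> t ` {..n} \<subseteq> {0..T}"

definition step_fun :: "nat \<Rightarrow> (nat \<Rightarrow> real) \<Rightarrow> (nat \<Rightarrow> real) \<Rightarrow> real \<Rightarrow> real" where
  "step_fun n t c s = (\<Sum>i<n. c i * indicator {t i<..t (Suc i)} s)"

definition step_integral ::
    "(real \<Rightarrow> 'a \<Rightarrow> real) \<Rightarrow> nat \<Rightarrow> (nat \<Rightarrow> real) \<Rightarrow> (nat \<Rightarrow> real) \<Rightarrow> 'a \<Rightarrow> real" where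
  "step_integral B n t c \<omega> = (\<Sum>i<n. c i * (B (t (Suc i)) \<omega> - B (t i) \<omega>))"

text \<open>
  The integral of \<open>h\<close> over \<open>[0, T]\<close> is the \<open>L\<^sup>2\<close>-limit of the integrals of step functions
  that converge to \<open>h\<close> in \<open>L\<^sup>2([0, T])\<close>. It is a class of random variables modulo null
  sets: if \<open>has_wiener_integral M B T h Y\<close> holds for some \<open>Y\<close>, then it holds for exactly the
  random variables that are almost surely equal to \<open>Y\<close>. \<open>wiener_integral\<close> picks a version.
\<close>

definition has_wiener_integral ::
    "'a measure \<Rightarrow> (real \<Rightarrow> 'a \<Rightarrow> real) \<Rightarrow> real \<Rightarrow> (real \<Rightarrow> real) \<Rightarrow> ('a \<Rightarrow> real) \<Rightarrow> bool" where
  "has_wiener_integral M B T h Y \<longleftrightarrow>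
     L2_fun (lebesgue_on {0..T}) h \<and> L2_fun M Y \<and>
     (\<exists>n t c. (\<forall>k. partition_points T (n k) (t k)) \<and>
        (\<lambda>k. integral\<^sup>L (lebesgue_on {0..T}) (\<lambda>s. (h s - step_fun (n k) (t k) (c k) s)\<^sup>2))
           \<longlonglongrightarrow> 0 \<and>
        (\<lambda>k. integral\<^sup>L M (\<lambda>\<omega>. (Y \<omega> - step_integral B (n k) (t k) (c k) \<omega>)\<^sup>2)) \<longlonglongrightarrow> 0)"

definition wiener_integral ::
    "'a measure \<Rightarrow> (real \<Rightarrow> 'a \<Rightarrow> real) \<Rightarrow> real \<Rightarrow> (real \<Rightarrow> real) \<Rightarrow> 'a \<Rightarrow> real" where
  "wiener_integral M B T h = (SOME Y. has_wiener_integral M B T h Y)"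

section \<open>The Wiener integral with respect to fractional Brownian motion\<close>

definition fbm_C1 :: "real \<Rightarrow> real" where
  "fbm_C1 H = sqrt (2 * H * Gamma (H + 1/2) * Gamma (3/2 - H) / Gamma (2 - 2 * H))"

definition fbm_K :: "real \<Rightarrow> real \<Rightarrow> (real \<Rightarrow> real) \<Rightarrow> real \<Rightarrow> real" where
  "fbm_K H T \<phi> t = - (fbm_C1 H * t powr (1/2 - H) / Gamma (H + 1/2)) *
     deriv (\<lambda>v. LINT u:{v..T}|lebesgue. (u - v) powr (H - 1/2) * u powr (H - 1/2) * \<phi> u) t"

definition fbm_K_star :: "real \<Rightarrow> real \<Rightarrow> (real \<Rightarrow> real) \<Rightarrow> real \<Rightarrow> real" where
  "fbm_K_star H T \<phi> t = inverse (fbm_C1 H) * t powr (1/2 - H) / Gamma (1/2 - H) *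
     (LINT u:{t..T}|lebesgue. (u - t) powr (- 1/2 - H) * u powr (H - 1/2) * \<phi> u)"

text \<open>
  The conjunct \<open>has_wiener_integral\<close> says that \<open>BH t\<close> is almost surely the integral of
  \<open>fbm_K H T 1\<^bsub>[0,t]\<^esub>\<close> over \<open>[0, t]\<close> with respect to \<open>B\<close>.
\<close>

definition underlying_wiener_process ::
    "'a measure \<Rightarrow> real \<Rightarrow> real \<Rightarrow> (real \<Rightarrow> 'a \<Rightarrow> real) \<Rightarrow> (real \<Rightarrow> 'a \<Rightarrow> real) \<Rightarrow> bool" where
  "underlying_wiener_process M H T BH B \<longleftrightarrow> wiener_process M {0..T} B \<and>
     (\<forall>t\<in>{0..T}. has_wiener_integral M B t (fbm_K H T (indicator {0..t})) (BH t))"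

text \<open>
  The identity \<open>f = fbm_K_star H T \<phi>\<close> is one between classes modulo Lebesgue null sets. Pointwise
  it would force \<open>f 0 = f T = 0\<close>.
\<close>

definition fbm_integrand :: "real \<Rightarrow> real \<Rightarrow> (real \<Rightarrow> real) \<Rightarrow> bool" where
  "fbm_integrand H T f \<longleftrightarrow>
     (\<exists>\<phi>. L2_fun (lebesgue_on {0..T}) \<phi> \<and> (AE t in lebesgue_on {0..T}. f t = fbm_K_star H T \<phi> t))"

text \<open>
  Here \<open>B\<close> is the underlying Wiener process of the fractional Brownian motion, and \<open>f\<close> is
  supposed to satisfy \<open>fbm_integrand H T f\<close>.
\<close>

definition fbm_wiener_integral ::
    "'a measure \<Rightarrow> real \<Rightarrow> (real \<Rightarrow> 'a \<Rightarrow> real) \<Rightarrow> real \<Rightarrow> (real \<Rightarrow> real) \<Rightarrow> 'a \<Rightarrow> real" where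
  "fbm_wiener_integral M H B T f = wiener_integral M B T (fbm_K H T f)"

section \<open>The Riemann(-Stieltjes) integral \<open>\<integral> g df\<close>\<close>

definition has_rs_integral ::
    "(real \<Rightarrow> real) \<Rightarrow> (real \<Rightarrow> real) \<Rightarrow> real \<Rightarrow> real \<Rightarrow> real \<Rightarrow> bool" where
  "has_rs_integral g f a b J \<longleftrightarrow>
     (\<forall>\<epsilon>>0. \<exists>\<delta>>0. \<forall>p. p tagged_division_of {a..b} \<and> (\<forall>(x, I)\<in>p. diameter I < \<delta>) \<longrightarrow>
        \<bar>(\<Sum>(x, I)\<in>p. g x * (f (Sup I) - f (Inf I))) - J\<bar> < \<epsilon>)"

definition rs_integrable :: "(real \<Rightarrow> real) \<Rightarrow> (real \<Rightarrow> real) \<Rightarrow> real \<Rightarrow> real \<Rightarrow> bool" where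
  "rs_integrable g f a b \<longleftrightarrow> (\<exists>J. has_rs_integral g f a b J)"

definition rs_integral :: "(real \<Rightarrow> real) \<Rightarrow> (real \<Rightarrow> real) \<Rightarrow> real \<Rightarrow> real \<Rightarrow> real" where
  "rs_integral g f a b = (THE J. has_rs_integral g f a b J)"

end

theory Submission
  imports Defs
begin

text \<open>
  Write \<open>a = 1/2 - H\<close> and let \<open>k\<^sub>t = fbm_K H T 1\<^bsub>[0,t]\<^esub>\<close> be the kernel with \<open>BH t = \<integral> k\<^sub>t dB\<close>.
  Integrating by parts inside the fractional derivative and applying Fubini on a triangle gives
  \<open>fbm_K H T f = f(T) k\<^sub>T - \<integral> f'(t) k\<^sub>t dt\<close>, and the Beta integral inverts \<open>fbm_K\<close>. Replacing
  \<open>\<integral> f'(t) k\<^sub>t dt\<close> by the sums \<open>\<Sum> (f(t\<^sub>i\<^sub>+\<^sub>1) - f(t\<^sub>i)) k\<^sub>t\<^sub>i\<close> yields functions whose Wiener integrals are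
  the Riemann--Stieltjes sums of the claim. They converge in \<open>L\<^sup>2\<close> because \<open>t \<mapsto> k\<^sub>t\<close> inherits the
  Hoelder continuity of \<open>t \<mapsto> BH t\<close> in mean square through the isometry, while the Riemann--Stieltjes
  sums converge pathwise; Fatou's lemma identifies the two limits.
\<close>

section \<open>Square-integrable functions\<close>

text \<open>No estimate of the singular kernel \<open>k\<^sub>t\<close> is made. Its square
  integrability and the size of its increments are read off the covariance of \<open>BH\<close>,
  since the hypothesis on \<open>B\<close> already presents \<open>BH t\<close> as the integral of
  \<open>k\<^sub>t\<close>; hence the isometry is needed from random variables back to functions as
  well. Square integrability of \<open>fbm_K H T f\<close>, and with it membership of
  \<open>f\<close> in the class of integrands, is then a by-product of the approximation by Riemann
  sums. The obstacle is the origin: the weight \<open>u powr (-a)\<close> is singular there, so its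
  product with \<open>f\<close> need not be continuously differentiable on the whole of
  \<open>{0..T}\<close>. The fractional calculus is therefore done on \<open>{r..T}\<close> and
  applied with \<open>r > 0\<close>, and identities for \<open>fbm_K\<close> are proved at interior
  points only; the values at \<open>0\<close>, \<open>t\<close> and \<open>T\<close> are dealt with
  by changing functions on finite sets. The range of \<open>H\<close> enters through
  \<open>0 < a < 1/2\<close>, which makes the exponents \<open>-a\<close> and \<open>a - 1\<close>
  integrable, and through \<open>2 * H > 0\<close>, which makes the mean-square error of the sums,
  of order mesh to the power \<open>2 * H\<close>, vanish.\<close>

lemma L2_fun_integrable_sq: "L2_fun N f \<Longrightarrow> integrable N (\<lambda>x. (f x)\<^sup>2)"
  by (simp add: L2_fun_def)

lemma L2_fun_mult_integrable:
  assumes "L2_fun N f" "L2_fun N g"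
  shows "integrable N (\<lambda>x. f x * g x)"
proof (rule Bochner_Integration.integrable_bound)
  show "integrable N (\<lambda>x. (f x)\<^sup>2 + (g x)\<^sup>2)"
    using assms by (auto simp: L2_fun_def)
  have "\<bar>a * b\<bar> \<le> a\<^sup>2 + b\<^sup>2" for a b :: real
  proof -
    have "2 * \<bar>a * b\<bar> \<le> a\<^sup>2 + b\<^sup>2"
      using sum_squares_bound[of "\<bar>a\<bar>" "\<bar>b\<bar>"] by (simp add: abs_mult)
    then show ?thesis by linarith
  qed
  then show "AE x in N. norm (f x * g x) \<le> norm ((f x)\<^sup>2 + (g x)\<^sup>2)"
    by (auto intro!: AE_I2 order_trans[OF _ abs_ge_self])
qed (use assms in \<open>auto simp: L2_fun_def\<close>)

lemma L2_fun_cmult: "L2_fun N f \<Longrightarrow> L2_fun N (\<lambda>x. a * f x)"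
  by (auto simp: L2_fun_def power_mult_distrib)

lemma L2_fun_add:
  assumes "L2_fun N f" "L2_fun N g"
  shows "L2_fun N (\<lambda>x. f x + g x)"
proof -
  have "integrable N (\<lambda>x. (f x)\<^sup>2 + (g x)\<^sup>2 + 2 * (f x * g x))"
    using L2_fun_mult_integrable[OF assms] assms by (auto simp: L2_fun_def)
  moreover have "(\<lambda>x. (f x + g x)\<^sup>2) = (\<lambda>x. (f x)\<^sup>2 + (g x)\<^sup>2 + 2 * (f x * g x))"
    by (simp add: power2_sum mult.assoc)
  ultimately show ?thesis
    using assms by (auto simp: L2_fun_def)
qed

lemma L2_fun_diff: "L2_fun N f \<Longrightarrow> L2_fun N g \<Longrightarrow> L2_fun N (\<lambda>x. f x - g x)"
  using L2_fun_add[OF _ L2_fun_cmult, of N f g "-1"] by simp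

lemma L2_fun_zero: "L2_fun N (\<lambda>_. 0)"
  by (auto simp: L2_fun_def)

lemma L2_fun_sum: "(\<And>i. i \<in> I \<Longrightarrow> L2_fun N (f i)) \<Longrightarrow> L2_fun N (\<lambda>x. \<Sum>i\<in>I. f i x)"
  by (induction I rule: infinite_finite_induct) (auto intro: L2_fun_zero L2_fun_add)

text \<open>Origin of the factors 2, 4 and 16 in the later bounds: it comes from
  \<open>(a + b)\<^sup>2 \<le> 2 * a\<^sup>2 + 2 * b\<^sup>2\<close> and plays the part of a
  triangle inequality.\<close>

lemma integral_sq_add_le:
  assumes "L2_fun N f" "L2_fun N g"
  shows "(\<integral>x. (f x + g x)\<^sup>2 \<partial>N) \<le> 2 * (\<integral>x. (f x)\<^sup>2 \<partial>N) + 2 * (\<integral>x. (g x)\<^sup>2 \<partial>N)"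
proof -
  have "(a + b)\<^sup>2 \<le> 2 * a\<^sup>2 + 2 * b\<^sup>2" for a b :: real
    using sum_squares_bound[of a b] by (simp add: power2_sum)
  then have "(\<integral>x. (f x + g x)\<^sup>2 \<partial>N) \<le> (\<integral>x. 2 * (f x)\<^sup>2 + 2 * (g x)\<^sup>2 \<partial>N)"
    using assms L2_fun_add[OF assms] by (intro integral_mono) (auto simp: L2_fun_def)
  also have "\<dots> = 2 * (\<integral>x. (f x)\<^sup>2 \<partial>N) + 2 * (\<integral>x. (g x)\<^sup>2 \<partial>N)"
    using assms by (subst Bochner_Integration.integral_add) (auto simp: L2_fun_def)
  finally show ?thesis .
qed

lemma integral_sq_diff_le:
  assumes "L2_fun N f" "L2_fun N g" "L2_fun N h"
  shows "(\<integral>x. (f x - h x)\<^sup>2 \<partial>N) \<le> 2 * (\<integral>x. (f x - g x)\<^sup>2 \<partial>N) + 2 * (\<integral>x. (g x - h x)\<^sup>2 \<partial>N)"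
  using integral_sq_add_le[OF L2_fun_diff[OF assms(1,2)] L2_fun_diff[OF assms(2,3)]] by simp

lemma integral_sq_le:
  assumes "L2_fun N f" "L2_fun N g"
  shows "(\<integral>x. (f x)\<^sup>2 \<partial>N) \<le> 2 * (\<integral>x. (f x - g x)\<^sup>2 \<partial>N) + 2 * (\<integral>x. (g x)\<^sup>2 \<partial>N)"
  using integral_sq_diff_le[OF assms L2_fun_zero] by simp

section \<open>Integrals of step functions\<close>

text \<open>A linear functional of \<open>F\<close> that covers two cases at once: a path of
  \<open>B\<close> gives the step integral, and \<open>F x = indicator {..x} s\<close> gives the
  value of the step function at \<open>s\<close>. Whatever is proved for all \<open>F\<close> holds
  for both.\<close>

definition incr_sum :: "nat \<Rightarrow> (nat \<Rightarrow> real) \<Rightarrow> (nat \<Rightarrow> real) \<Rightarrow> (real \<Rightarrow> real) \<Rightarrow> real" where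
  "incr_sum n t c F = (\<Sum>i<n. c i * (F (t (Suc i)) - F (t i)))"

lemma step_integral_eq_incr_sum: "step_integral B n t c \<omega> = incr_sum n t c (\<lambda>x. B x \<omega>)"
  by (simp add: step_integral_def incr_sum_def)

lemma step_fun_eq_incr_sum:
  assumes "partition_points T n t"
  shows "step_fun n t c s = incr_sum n t c (\<lambda>x. indicator {..x} s)"
proof -
  have "t i \<le> t (Suc i)" if "i < n" for i
    using assms that by (auto simp: partition_points_def mono_on_def)
  then have "indicator {t i<..t (Suc i)} s = (indicator {..t (Suc i)} s - indicator {..t i} s :: real)"
    if "i < n" for i
    using that by (fastforce simp: indicator_def)
  then show ?thesis
    unfolding step_fun_def incr_sum_def by (intro sum.cong refl) simp
qed

lemma incr_sum_add: "incr_sum n t (\<lambda>i. c i + d i) F = incr_sum n t c F + incr_sum n t d F"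
  by (simp add: incr_sum_def distrib_right sum.distrib)

lemma incr_sum_cmult: "incr_sum n t (\<lambda>i. a * c i) F = a * incr_sum n t c F"
  by (simp add: incr_sum_def sum_distrib_left mult.assoc)

text \<open>Telescoping from index \<open>0\<close> to \<open>p\<close> and to \<open>q\<close>;
  being a difference of two such sums, the formula covers \<open>p \<le> q\<close> and
  \<open>q < p\<close> alike.\<close>

lemma increment_eq_incr_sum:
  assumes "p \<le> n" "q \<le> n"
  shows "F (t q) - F (t p) = incr_sum n t (\<lambda>i. of_bool (i < q) - of_bool (i < p)) F"
proof -
  have *: "(\<Sum>i<n. of_bool (i < r) * (F (t (Suc i)) - F (t i))) = F (t r) - F (t 0)" if "r \<le> n" for r
  proof -
    have "(\<Sum>i<n. of_bool (i < r) * (F (t (Suc i)) - F (t i))) = (\<Sum>i<r. F (t (Suc i)) - F (t i))"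
      using that by (intro sum.mono_neutral_cong_right) auto
    also have "\<dots> = F (t r) - F (t 0)"
      by (rule sum_lessThan_telescope)
    finally show ?thesis .
  qed
  show ?thesis
    using *[OF assms(1)] *[OF assms(2)]
    by (simp add: incr_sum_def left_diff_distrib sum_subtractf)
qed

text \<open>The point is that \<open>e\<close> does not depend on \<open>F\<close>, so that one
  refinement acts simultaneously on step functions and on step integrals.\<close>

lemma incr_sum_refine:
  assumes "t ` {..n} \<subseteq> r ` {..N}"
  shows "\<exists>e. \<forall>F. incr_sum n t c F = incr_sum N r e F"
  using assms
proof (induction n)
  case 0
  show ?case by (intro exI[of _ "\<lambda>_. 0"]) (simp add: incr_sum_def)
next
  case (Suc n)
  from Suc.prems have "t ` {..n} \<subseteq> r ` {..N}" by auto
  with Suc.IH obtain e where e: "\<And>F. incr_sum n t c F = incr_sum N r e F" by blast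
  have "t n \<in> r ` {..N}" "t (Suc n) \<in> r ` {..N}"
    using Suc.prems by auto
  then obtain p q where pq: "p \<le> N" "q \<le> N" "t n = r p" "t (Suc n) = r q"
    by blast
  have "incr_sum (Suc n) t c F = incr_sum n t c F + c n * (F (r q) - F (r p))" for F
    using pq by (simp add: incr_sum_def)
  then show ?case
    by (intro exI[of _ "\<lambda>i. e i + c n * (of_bool (i < q) - of_bool (i < p))"])
      (simp add: incr_sum_add incr_sum_cmult e increment_eq_incr_sum[OF pq(1,2), of _ r])
qed

text \<open>Both sums are rewritten over the common refinement, the sorted union of their partition
  points, where linear combinations are formed coefficientwise.\<close>

lemma incr_sum_linear:
  assumes "partition_points T n t" "partition_points T m s"
  obtains N r e where "partition_points T N r"
    "\<And>F. incr_sum N r e F = a * incr_sum n t c F + b * incr_sum m s d F"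
proof -
  define xs where "xs = sorted_list_of_set (t ` {..n} \<union> s ` {..m})"
  define N where "N = length xs - 1"
  have set: "set xs = t ` {..n} \<union> s ` {..m}"
    by (simp add: xs_def)
  then have "xs \<noteq> []" by auto
  then have N: "{..N} = {0..<length xs}"
    by (cases xs) (auto simp: N_def)
  then have img: "(!) xs ` {..N} = t ` {..n} \<union> s ` {..m}"
    using nth_image[of "length xs" xs] by (simp add: set)
  have "sorted xs"
    unfolding xs_def by (rule sorted_sorted_list_of_set)
  then have "mono_on {..N} ((!) xs)"
    unfolding N by (intro mono_onI) (auto intro: sorted_nth_mono)
  with img assms have "partition_points T N ((!) xs)"
    by (auto simp: partition_points_def)
  moreover obtain e1 e2 where "\<And>F. incr_sum n t c F = incr_sum N ((!) xs) e1 F"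
    "\<And>F. incr_sum m s d F = incr_sum N ((!) xs) e2 F"
    using incr_sum_refine[of t n "(!) xs" N c] incr_sum_refine[of s m "(!) xs" N d] img by auto
  ultimately show ?thesis
    by (intro that[of N "(!) xs" "\<lambda>i. a * e1 i + b * e2 i"]) (simp_all add: incr_sum_add incr_sum_cmult)
qed

lemma incr_sum_L2:
  assumes "\<And>x. x \<in> {0..T} \<Longrightarrow> L2_fun N (X x)" "partition_points T n t"
  shows "L2_fun N (\<lambda>\<omega>. incr_sum n t c (\<lambda>x. X x \<omega>))"
  unfolding incr_sum_def using assms
  by (intro L2_fun_sum L2_fun_cmult L2_fun_diff) (auto simp: partition_points_def image_subset_iff)

text \<open>Only the covariance \<open>min\<close> enters. Brownian motion under \<open>M\<close>
  and half-line indicators under Lebesgue measure share it, so both obtain the same right-hand side;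
  this is the isometry on step functions.\<close>

lemma integral_incr_sum_sq:
  assumes L2: "\<And>x. x \<in> {0..T} \<Longrightarrow> L2_fun N (X x)"
    and cov: "\<And>x y. x \<in> {0..T} \<Longrightarrow> y \<in> {0..T} \<Longrightarrow> (\<integral>\<omega>. X x \<omega> * X y \<omega> \<partial>N) = min x y"
    and t: "partition_points T n t"
  shows "(\<integral>\<omega>. (incr_sum n t c (\<lambda>x. X x \<omega>))\<^sup>2 \<partial>N) =
    (\<Sum>i<n. \<Sum>j<n. c i * c j * (min (t (Suc i)) (t (Suc j)) - min (t (Suc i)) (t j)
        - min (t i) (t (Suc j)) + min (t i) (t j)))"
proof -
  have t': "t i \<in> {0..T}" if "i \<le> n" for i
    using t that by (auto simp: partition_points_def image_subset_iff)
  have int: "integrable N (\<lambda>\<omega>. X (t i) \<omega> * X (t j) \<omega>)" if "i \<le> n" "j \<le> n" for i j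
    using that by (intro L2_fun_mult_integrable L2 t')
  have hb: "has_bochner_integral N (\<lambda>\<omega>. X (t i) \<omega> * X (t j) \<omega>) (min (t i) (t j))" if "i \<le> n" "j \<le> n" for i j
    using int[OF that] cov[OF t'[OF that(1)] t'[OF that(2)]] by (simp add: has_bochner_integral_iff)
  have "(incr_sum n t c (\<lambda>x. X x \<omega>))\<^sup>2 = (\<Sum>i<n. \<Sum>j<n. c i * c j *
      (X (t (Suc i)) \<omega> * X (t (Suc j)) \<omega> - X (t (Suc i)) \<omega> * X (t j) \<omega>
        - X (t i) \<omega> * X (t (Suc j)) \<omega> + X (t i) \<omega> * X (t j) \<omega>))" for \<omega>
    unfolding incr_sum_def power2_eq_square sum_product
    by (intro sum.cong refl) (simp add: algebra_simps)
  moreover have "has_bochner_integral N (\<lambda>\<omega>. \<Sum>i<n. \<Sum>j<n. c i * c j *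
      (X (t (Suc i)) \<omega> * X (t (Suc j)) \<omega> - X (t (Suc i)) \<omega> * X (t j) \<omega>
        - X (t i) \<omega> * X (t (Suc j)) \<omega> + X (t i) \<omega> * X (t j) \<omega>))
      (\<Sum>i<n. \<Sum>j<n. c i * c j * (min (t (Suc i)) (t (Suc j)) - min (t (Suc i)) (t j)
        - min (t i) (t (Suc j)) + min (t i) (t j)))"
    by (intro has_bochner_integral_sum has_bochner_integral_mult_right
        has_bochner_integral_add has_bochner_integral_diff hb) auto
  ultimately show ?thesis
    by (simp add: has_bochner_integral_iff)
qed

section \<open>The Wiener integral\<close>

lemma indicator_L2_lebesgue_on: "L2_fun (lebesgue_on {0..T}) (\<lambda>s. indicator {..x} s :: real)"
  and indicator_cov_lebesgue_on: "x \<in> {0..T} \<Longrightarrow> y \<in> {0..T} \<Longrightarrow>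
    (\<integral>s. indicator {..x} s * indicator {..y} s \<partial>lebesgue_on {0..T}) = min x (y::real)"
proof -
  have [simp]: "(indicator {..x} s)\<^sup>2 = (indicator {..x} s :: real)" for s :: real
    by (simp add: indicator_def)
  have "integrable (lebesgue_on {0..T}) (\<lambda>s. indicator {..x} s :: real)"
  proof (subst integrable_restrict_space)
    have "emeasure lborel ({0..T} \<inter> {..x}) \<le> emeasure lborel {0..T}"
      by (intro emeasure_mono) auto
    also have "\<dots> < \<infinity>"
      by (simp add: emeasure_lborel_Icc_eq)
    finally show "integrable lebesgue (\<lambda>s. indicator {0..T} s *\<^sub>R (indicator {..x} s :: real))"
      by (simp add: indicator_inter_arith[symmetric])
  qed simp
  then show "L2_fun (lebesgue_on {0..T}) (\<lambda>s. indicator {..x} s :: real)"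
    by (simp add: L2_fun_def)
  assume *: "x \<in> {0..T}" "y \<in> {0..T}"
  have "(\<integral>s. indicator {..x} s * indicator {..y} s \<partial>lebesgue_on {0..T}) =
      (\<integral>s. indicator {0..T} s *\<^sub>R (indicator {..x} s * indicator {..y} s :: real) \<partial>lebesgue)"
    by (rule integral_restrict_space) simp
  also have "\<dots> = (\<integral>s. indicator {0..min x y} s \<partial>lebesgue)"
    using * by (intro Bochner_Integration.integral_cong refl) (auto simp: indicator_def)
  finally have "(\<integral>s. indicator {..x} s * indicator {..y} s \<partial>lebesgue_on {0..T}) =
      (\<integral>s. indicator {0..min x y} s \<partial>lebesgue :: real)" .
  with * show "(\<integral>s. indicator {..x} s * indicator {..y} s \<partial>lebesgue_on {0..T}) = min x y"
    by (simp add: measure_def)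
qed

text \<open>The moment identities of a Gaussian process do not yield integrability, as the integral
  of a nonintegrable function is \<open>0\<close> by convention. Finite second moments have to come
  from the Gaussian law.\<close>

lemma gaussian_rv_L2:
  assumes "prob_space M" "gaussian_rv M Y"
  shows "L2_fun M Y"
proof -
  interpret prob_space M by fact
  have [measurable]: "Y \<in> borel_measurable M"
    using assms by (simp add: gaussian_rv_def)
  consider \<mu> where "AE \<omega> in M. Y \<omega> = \<mu>"
    | \<mu> \<sigma> where "\<sigma> > 0" "distributed M lborel Y (\<lambda>x. ennreal (normal_density \<mu> \<sigma> x))"
    using assms by (auto simp: gaussian_rv_def)
  then have "integrable M (\<lambda>\<omega>. (Y \<omega>)\<^sup>2)"
  proof cases
    case 1
    then have "AE \<omega> in M. \<mu>\<^sup>2 = (Y \<omega>)\<^sup>2" by auto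
    from integrable_cong_AE_imp[OF _ _ this] show ?thesis by simp
  next
    case 2
    \<comment> \<open>The decomposition \<open>x\<^sup>2 = (x - \<mu>)\<^sup>2 + 2 * \<mu> * x -
      \<mu>\<^sup>2\<close> reduces the second moment to a centered one and to the mean.\<close>
    have "integrable lborel (\<lambda>x. normal_density \<mu> \<sigma> x * (x - \<mu>) ^ (2 * 1) +
        2 * \<mu> * (normal_density \<mu> \<sigma> x * x) - \<mu>\<^sup>2 * normal_density \<mu> \<sigma> x)"
      using integrable_normal_moment[OF 2(1), of \<mu> 2] 2(1)
      by (intro Bochner_Integration.integrable_add Bochner_Integration.integrable_diff integrable_mult_right
        integrable_normal_moment_nz_1) auto
    then have "integrable lborel (\<lambda>x. normal_density \<mu> \<sigma> x * x\<^sup>2)"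
      by (rule Bochner_Integration.integrable_cong[THEN iffD1, rotated -1])
        (simp_all add: power2_eq_square algebra_simps)
    then show ?thesis
      using distributed_integrable[OF 2(2), of "\<lambda>x. x\<^sup>2"] by simp
  qed
  then show ?thesis by (simp add: L2_fun_def)
qed

lemma centered_gaussian_process_L2:
  assumes "centered_gaussian_process M I X R" "t \<in> I"
  shows "L2_fun M (X t)"
proof -
  have "\<forall>J c. finite J \<and> J \<subseteq> I \<longrightarrow> gaussian_rv M (\<lambda>\<omega>. \<Sum>t\<in>J. c t * X t \<omega>)"
    using assms by (simp add: centered_gaussian_process_def)
  from this[rule_format, of "{t}" "\<lambda>_. 1"] have "gaussian_rv M (X t)"
    using assms(2) by simp
  then show ?thesis
    using assms by (intro gaussian_rv_L2) (simp_all add: centered_gaussian_process_def)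
qed

lemma wiener_process_cov:
  assumes "wiener_process M {0..T} B" "x \<in> {0..T}" "y \<in> {0..T}"
  shows "(\<integral>\<omega>. B x \<omega> * B y \<omega> \<partial>M) = min x y"
  using assms by (simp add: wiener_process_def centered_gaussian_process_def)

lemma wiener_process_L2:
  assumes "wiener_process M {0..T} B" "x \<in> {0..T}"
  shows "L2_fun M (B x)"
  using assms by (auto simp: wiener_process_def intro: centered_gaussian_process_L2)

lemma step_integral_L2:
  assumes "wiener_process M {0..T} B" "partition_points T n t"
  shows "L2_fun M (step_integral B n t c)"
  using incr_sum_L2[OF wiener_process_L2[OF assms(1)] assms(2)]
  by (simp add: step_integral_eq_incr_sum[abs_def])

lemma step_fun_L2:
  assumes "partition_points T n t"
  shows "L2_fun (lebesgue_on {0..T}) (step_fun n t c)"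
proof -
  have "L2_fun (lebesgue_on {0..T}) (\<lambda>s. incr_sum n t c (\<lambda>x. indicator {..x} s))"
    by (rule incr_sum_L2[OF indicator_L2_lebesgue_on assms])
  then show ?thesis
    unfolding step_fun_eq_incr_sum[OF assms, symmetric] .
qed

lemma step_isometry:
  assumes W: "wiener_process M {0..T} B" and t: "partition_points T n t"
  shows "(\<integral>\<omega>. (step_integral B n t c \<omega>)\<^sup>2 \<partial>M) = (\<integral>s. (step_fun n t c s)\<^sup>2 \<partial>lebesgue_on {0..T})"
proof -
  note integral_incr_sum_sq[OF wiener_process_L2[OF W] wiener_process_cov[OF W] t, where c=c]
  also note integral_incr_sum_sq[OF indicator_L2_lebesgue_on indicator_cov_lebesgue_on t, where c=c, symmetric]
  finally show ?thesis
    by (simp add: step_integral_eq_incr_sum step_fun_eq_incr_sum[OF t])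
qed

text \<open>One step function per tolerance replaces the approximating sequences; the converse
  selects one for each tolerance \<open>1 / (k + 1)\<close>.\<close>

lemma has_wiener_integral_iff:
  "has_wiener_integral M B T h Y \<longleftrightarrow> L2_fun (lebesgue_on {0..T}) h \<and> L2_fun M Y \<and>
    (\<forall>e>0. \<exists>n t c. partition_points T n t \<and>
      (\<integral>s. (h s - step_fun n t c s)\<^sup>2 \<partial>lebesgue_on {0..T}) < e \<and>
      (\<integral>\<omega>. (Y \<omega> - step_integral B n t c \<omega>)\<^sup>2 \<partial>M) < e)" (is "?lhs \<longleftrightarrow> ?rhs")
proof
  assume ?lhs
  then obtain n t c where L2: "L2_fun (lebesgue_on {0..T}) h" "L2_fun M Y"
    and p: "\<And>k. partition_points T (n k) (t k)"
    and lim: "(\<lambda>k. \<integral>s. (h s - step_fun (n k) (t k) (c k) s)\<^sup>2 \<partial>lebesgue_on {0..T}) \<longlonglongrightarrow> 0"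
      "(\<lambda>k. \<integral>\<omega>. (Y \<omega> - step_integral B (n k) (t k) (c k) \<omega>)\<^sup>2 \<partial>M) \<longlonglongrightarrow> 0"
    by (auto simp: has_wiener_integral_def)
  have "\<exists>n t c. partition_points T n t \<and>
      (\<integral>s. (h s - step_fun n t c s)\<^sup>2 \<partial>lebesgue_on {0..T}) < e \<and>
      (\<integral>\<omega>. (Y \<omega> - step_integral B n t c \<omega>)\<^sup>2 \<partial>M) < e" if "e > 0" for e
  proof -
    from eventually_happens'[OF sequentially_bot eventually_conj[OF
        order_tendstoD(2)[OF lim(1) that] order_tendstoD(2)[OF lim(2) that]]]
    obtain k where "(\<integral>s. (h s - step_fun (n k) (t k) (c k) s)\<^sup>2 \<partial>lebesgue_on {0..T}) < e"
      "(\<integral>\<omega>. (Y \<omega> - step_integral B (n k) (t k) (c k) \<omega>)\<^sup>2 \<partial>M) < e"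
      by blast
    with p show ?thesis by blast
  qed
  with L2 show ?rhs by blast
next
  assume R: ?rhs
  have "\<forall>k. \<exists>n t c. partition_points T n t \<and>
      (\<integral>s. (h s - step_fun n t c s)\<^sup>2 \<partial>lebesgue_on {0..T}) < inverse (real (Suc k)) \<and>
      (\<integral>\<omega>. (Y \<omega> - step_integral B n t c \<omega>)\<^sup>2 \<partial>M) < inverse (real (Suc k))"
    using R by simp
  from this[unfolded choice_iff] obtain n t c where p: "\<And>k. partition_points T (n k) (t k)"
    and h: "\<And>k. (\<integral>s. (h s - step_fun (n k) (t k) (c k) s)\<^sup>2 \<partial>lebesgue_on {0..T}) < inverse (real (Suc k))"
    and Y: "\<And>k. (\<integral>\<omega>. (Y \<omega> - step_integral B (n k) (t k) (c k) \<omega>)\<^sup>2 \<partial>M) < inverse (real (Suc k))"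
    by blast
  have "(\<lambda>k. \<integral>s. (h s - step_fun (n k) (t k) (c k) s)\<^sup>2 \<partial>lebesgue_on {0..T}) \<longlonglongrightarrow> 0"
    by (rule tendsto_sandwich[OF _ _ tendsto_const LIMSEQ_inverse_real_of_nat])
      (use h in \<open>auto intro!: always_eventually less_imp_le simp del: of_nat_Suc\<close>)
  moreover have "(\<lambda>k. \<integral>\<omega>. (Y \<omega> - step_integral B (n k) (t k) (c k) \<omega>)\<^sup>2 \<partial>M) \<longlonglongrightarrow> 0"
    by (rule tendsto_sandwich[OF _ _ tendsto_const LIMSEQ_inverse_real_of_nat])
      (use Y in \<open>auto intro!: always_eventually less_imp_le simp del: of_nat_Suc\<close>)
  ultimately show ?lhs
    using R p unfolding has_wiener_integral_def by blast
qed

lemma has_wiener_integral_L2: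
  assumes "has_wiener_integral M B T h Y"
  shows "L2_fun (lebesgue_on {0..T}) h" "L2_fun M Y"
  using assms by (auto simp: has_wiener_integral_def)

lemma has_wiener_integral_linear:
  assumes W: "wiener_process M {0..T} B"
    and "has_wiener_integral M B T h Y" "has_wiener_integral M B T g Z"
  shows "has_wiener_integral M B T (\<lambda>s. a * h s + b * g s) (\<lambda>\<omega>. a * Y \<omega> + b * Z \<omega>)"
  unfolding has_wiener_integral_iff
proof (intro conjI allI impI)
  note L2 = has_wiener_integral_L2[OF assms(2)] has_wiener_integral_L2[OF assms(3)]
  show "L2_fun (lebesgue_on {0..T}) (\<lambda>s. a * h s + b * g s)" "L2_fun M (\<lambda>\<omega>. a * Y \<omega> + b * Z \<omega>)"
    by (intro L2_fun_add L2_fun_cmult L2)+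
  fix e :: real assume "e > 0"
  \<comment> \<open>Errors below \<open>d\<close> in the two integrands combine to less than
    \<open>2 * (a\<^sup>2 + b\<^sup>2) * d\<close>, up to equality when \<open>a = b = 0\<close>;
    the summand 1 makes the inequality strict and the denominator positive in that case too.\<close>
  define d where "d = e / (2 * (a\<^sup>2 + b\<^sup>2) + 1)"
  have pos: "2 * (a\<^sup>2 + b\<^sup>2) + 1 > 0"
    by (simp add: add_nonneg_pos)
  with \<open>e > 0\<close> have "d > 0" by (simp add: d_def)
  have d: "2 * (a\<^sup>2 * x) + 2 * (b\<^sup>2 * y) < e" if "x < d" "y < d" for x y
  proof -
    have "2 * (a\<^sup>2 * x) + 2 * (b\<^sup>2 * y) \<le> 2 * (a\<^sup>2 * d) + 2 * (b\<^sup>2 * d)"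
      using that by (intro add_mono mult_left_mono) auto
    also have "\<dots> < (2 * (a\<^sup>2 + b\<^sup>2) + 1) * d"
      using \<open>d > 0\<close> by (simp add: algebra_simps)
    finally show ?thesis using pos by (simp add: d_def)
  qed
  from assms(2) \<open>d > 0\<close> obtain n t c where 1: "partition_points T n t"
      "(\<integral>s. (h s - step_fun n t c s)\<^sup>2 \<partial>lebesgue_on {0..T}) < d"
      "(\<integral>\<omega>. (Y \<omega> - step_integral B n t c \<omega>)\<^sup>2 \<partial>M) < d"
    unfolding has_wiener_integral_iff by blast
  from assms(3) \<open>d > 0\<close> obtain m s v where 2: "partition_points T m s"
      "(\<integral>x. (g x - step_fun m s v x)\<^sup>2 \<partial>lebesgue_on {0..T}) < d"
      "(\<integral>\<omega>. (Z \<omega> - step_integral B m s v \<omega>)\<^sup>2 \<partial>M) < d"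
    unfolding has_wiener_integral_iff by blast
  obtain N r w where 3: "partition_points T N r"
      "\<And>F. incr_sum N r w F = a * incr_sum n t c F + b * incr_sum m s v F"
    using incr_sum_linear[OF 1(1) 2(1), where a=a and c=c and b=b and d=v] by blast
  \<comment> \<open>Stated for an arbitrary measure because it is used twice: for integrands on
    \<open>{0..T}\<close> and for random variables on \<open>M\<close>.\<close>
  have *: "(\<integral>x. (a * p x + b * q x - (a * p' x + b * q' x))\<^sup>2 \<partial>N) < e"
    if "L2_fun N p" "L2_fun N p'" "L2_fun N q" "L2_fun N q'"
      "(\<integral>x. (p x - p' x)\<^sup>2 \<partial>N) < d" "(\<integral>x. (q x - q' x)\<^sup>2 \<partial>N) < d" for N :: "'c measure" and p p' q q'
  proof -
    have "(\<integral>x. (a * p x + b * q x - (a * p' x + b * q' x))\<^sup>2 \<partial>N) =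
        (\<integral>x. (a * (p x - p' x) + b * (q x - q' x))\<^sup>2 \<partial>N)"
      by (simp add: algebra_simps)
    also have "\<dots> \<le> 2 * (\<integral>x. (a * (p x - p' x))\<^sup>2 \<partial>N) + 2 * (\<integral>x. (b * (q x - q' x))\<^sup>2 \<partial>N)"
      by (intro integral_sq_add_le L2_fun_cmult L2_fun_diff that)
    also have "\<dots> < e"
      using d[OF that(5,6)] by (simp add: power_mult_distrib)
    finally show ?thesis .
  qed
  show "\<exists>n t c. partition_points T n t \<and>
      (\<integral>s. (a * h s + b * g s - step_fun n t c s)\<^sup>2 \<partial>lebesgue_on {0..T}) < e \<and>
      (\<integral>\<omega>. (a * Y \<omega> + b * Z \<omega> - step_integral B n t c \<omega>)\<^sup>2 \<partial>M) < e"
  proof (intro exI conjI)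
    show "partition_points T N r" by fact
    have "step_fun N r w x = a * step_fun n t c x + b * step_fun m s v x" for x
      using 1(1) 2(1) 3 by (simp add: step_fun_eq_incr_sum[of T])
    then show "(\<integral>x. (a * h x + b * g x - step_fun N r w x)\<^sup>2 \<partial>lebesgue_on {0..T}) < e"
      using *[OF L2(1) step_fun_L2[OF 1(1)] L2(3) step_fun_L2[OF 2(1)] 1(2) 2(2)] by simp
    have "step_integral B N r w x = a * step_integral B n t c x + b * step_integral B m s v x" for x
      by (simp add: step_integral_eq_incr_sum 3)
    then show "(\<integral>\<omega>. (a * Y \<omega> + b * Z \<omega> - step_integral B N r w \<omega>)\<^sup>2 \<partial>M) < e"
      using *[OF L2(2) step_integral_L2[OF W 1(1)] L2(4) step_integral_L2[OF W 2(1)] 1(3) 2(3)] by simp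
  qed
qed

lemma has_wiener_integral_zero: "0 \<le> T \<Longrightarrow> has_wiener_integral M B T (\<lambda>_. 0) (\<lambda>_. 0)"
  unfolding has_wiener_integral_iff
proof (intro conjI allI impI L2_fun_zero)
  fix e :: real assume "0 \<le> T" "e > 0"
  then show "\<exists>n t c. partition_points T n t \<and>
      (\<integral>s. (0 - step_fun n t c s)\<^sup>2 \<partial>lebesgue_on {0..T}) < e \<and>
      (\<integral>\<omega>. (0 - step_integral B n t c \<omega>)\<^sup>2 \<partial>M) < e"
    by (intro exI[of _ "0::nat"] exI[of _ "\<lambda>_. 0"])
      (simp add: partition_points_def step_fun_def step_integral_def mono_on_def)
qed

lemma has_wiener_integral_sum:
  assumes "wiener_process M {0..T} B" "0 \<le> T" "finite I"
    and "\<And>i. i \<in> I \<Longrightarrow> has_wiener_integral M B T (h i) (Y i)"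
  shows "has_wiener_integral M B T (\<lambda>s. \<Sum>i\<in>I. a i * h i s) (\<lambda>\<omega>. \<Sum>i\<in>I. a i * Y i \<omega>)"
  using assms(3,4)
proof (induction I rule: finite_induct)
  case empty
  show ?case using has_wiener_integral_zero[OF assms(2)] by simp
next
  case (insert i I)
  then have "has_wiener_integral M B T (\<lambda>s. a i * h i s + 1 * (\<Sum>i\<in>I. a i * h i s))
      (\<lambda>\<omega>. a i * Y i \<omega> + 1 * (\<Sum>i\<in>I. a i * Y i \<omega>))"
    by (intro has_wiener_integral_linear assms(1) insert.IH insert.prems) auto
  with insert.hyps show ?case by simp
qed

text \<open>The Wiener integral is an isometry; the cruder bounds with the constant \<open>4\<close> do as well
  here and need no Minkowski inequality.\<close>

lemma has_wiener_integral_bounds: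
  assumes W: "wiener_process M {0..T} B" and "has_wiener_integral M B T h Y"
  shows "(\<integral>\<omega>. (Y \<omega>)\<^sup>2 \<partial>M) \<le> 4 * (\<integral>s. (h s)\<^sup>2 \<partial>lebesgue_on {0..T})"
    and "(\<integral>s. (h s)\<^sup>2 \<partial>lebesgue_on {0..T}) \<le> 4 * (\<integral>\<omega>. (Y \<omega>)\<^sup>2 \<partial>M)"
proof -
  note L2 = has_wiener_integral_L2[OF assms(2)]
  have *: "(\<integral>\<omega>. (Y \<omega>)\<^sup>2 \<partial>M) \<le> 4 * (\<integral>s. (h s)\<^sup>2 \<partial>lebesgue_on {0..T}) + e \<and>
      (\<integral>s. (h s)\<^sup>2 \<partial>lebesgue_on {0..T}) \<le> 4 * (\<integral>\<omega>. (Y \<omega>)\<^sup>2 \<partial>M) + e" if "e > 0" for e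
  proof -
    \<comment> \<open>Passing from \<open>Y\<close> to the step integral and from the step function
      to \<open>h\<close> costs \<open>2 * (e / 6)\<close> and \<open>4 * (e / 6)\<close>, together
      \<open>e\<close>; the two doublings also produce the constant 4.\<close>
    from that have "e / 6 > 0" by simp
    with assms(2) obtain n t c where 1: "partition_points T n t"
        "(\<integral>s. (h s - step_fun n t c s)\<^sup>2 \<partial>lebesgue_on {0..T}) < e / 6"
        "(\<integral>\<omega>. (Y \<omega> - step_integral B n t c \<omega>)\<^sup>2 \<partial>M) < e / 6"
      unfolding has_wiener_integral_iff by blast
    note L2' = step_fun_L2[OF 1(1), of c] step_integral_L2[OF W 1(1), of c]
    show ?thesis
      using 1(2,3) integral_sq_le[OF L2(1) L2'(1)] integral_sq_le[OF L2(2) L2'(2)]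
        integral_sq_le[OF L2'(1) L2(1)] integral_sq_le[OF L2'(2) L2(2)] step_isometry[OF W 1(1), of c]
      by (simp add: power2_commute[of "step_fun n t c _"] power2_commute[of "step_integral B n t c _"])
  qed
  show "(\<integral>\<omega>. (Y \<omega>)\<^sup>2 \<partial>M) \<le> 4 * (\<integral>s. (h s)\<^sup>2 \<partial>lebesgue_on {0..T})"
    by (rule field_le_epsilon) (use * in blast)
  show "(\<integral>s. (h s)\<^sup>2 \<partial>lebesgue_on {0..T}) \<le> 4 * (\<integral>\<omega>. (Y \<omega>)\<^sup>2 \<partial>M)"
    by (rule field_le_epsilon) (use * in blast)
qed

text \<open>By linearity \<open>Y - Z\<close> is an integral of the zero function, so the bound
  forces its second moment to vanish.\<close>

lemma has_wiener_integral_unique: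
  assumes W: "wiener_process M {0..T} B"
    and "has_wiener_integral M B T h Y" "has_wiener_integral M B T h Z"
  shows "AE \<omega> in M. Y \<omega> = Z \<omega>"
proof -
  have "has_wiener_integral M B T (\<lambda>s. 1 * h s + (-1) * h s) (\<lambda>\<omega>. 1 * Y \<omega> + (-1) * Z \<omega>)"
    by (intro has_wiener_integral_linear assms)
  then have "has_wiener_integral M B T (\<lambda>s. 0) (\<lambda>\<omega>. Y \<omega> - Z \<omega>)"
    by simp
  from has_wiener_integral_bounds(1)[OF W this] has_wiener_integral_L2(2)[OF this]
  have "integrable M (\<lambda>\<omega>. (Y \<omega> - Z \<omega>)\<^sup>2)" "(\<integral>\<omega>. (Y \<omega> - Z \<omega>)\<^sup>2 \<partial>M) = 0"
    by (auto simp: L2_fun_def intro!: antisym)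
  then have "AE \<omega> in M. (Y \<omega> - Z \<omega>)\<^sup>2 = 0"
    by (subst (asm) integral_nonneg_eq_0_iff_AE) auto
  then show ?thesis by eventually_elim simp
qed

text \<open>One index \<open>k\<close> close to both limits is fixed first, then a step function
  close to \<open>h' k\<close>; the doublings in \<open>integral_sq_diff_le\<close> account for the
  quarters of \<open>e\<close>.\<close>

lemma has_wiener_integral_limit:
  assumes W: "wiener_process M {0..T} B"
    and L2: "L2_fun (lebesgue_on {0..T}) h" "L2_fun M Y"
    and wi: "\<And>n. has_wiener_integral M B T (h' n) (Y' n)"
    and lim: "(\<lambda>n. \<integral>s. (h s - h' n s)\<^sup>2 \<partial>lebesgue_on {0..T}) \<longlonglongrightarrow> 0"
      "(\<lambda>n. \<integral>\<omega>. (Y \<omega> - Y' n \<omega>)\<^sup>2 \<partial>M) \<longlonglongrightarrow> 0"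
  shows "has_wiener_integral M B T h Y"
  unfolding has_wiener_integral_iff
proof (intro conjI L2 allI impI)
  fix e :: real assume "e > 0"
  then have "e / 4 > 0" by simp
  from eventually_happens'[OF sequentially_bot eventually_conj[OF
      order_tendstoD(2)[OF lim(1) this] order_tendstoD(2)[OF lim(2) this]]]
  obtain k where k: "(\<integral>s. (h s - h' k s)\<^sup>2 \<partial>lebesgue_on {0..T}) < e / 4"
    "(\<integral>\<omega>. (Y \<omega> - Y' k \<omega>)\<^sup>2 \<partial>M) < e / 4"
    by blast
  from wi[of k] \<open>e / 4 > 0\<close> obtain n t c where 1: "partition_points T n t"
      "(\<integral>s. (h' k s - step_fun n t c s)\<^sup>2 \<partial>lebesgue_on {0..T}) < e / 4"
      "(\<integral>\<omega>. (Y' k \<omega> - step_integral B n t c \<omega>)\<^sup>2 \<partial>M) < e / 4"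
    unfolding has_wiener_integral_iff by blast
  have "(\<integral>s. (h s - step_fun n t c s)\<^sup>2 \<partial>lebesgue_on {0..T}) < e"
    using k 1 integral_sq_diff_le[OF L2(1) has_wiener_integral_L2(1)[OF wi[of k]] step_fun_L2[OF 1(1), of c]]
    by linarith
  moreover have "(\<integral>\<omega>. (Y \<omega> - step_integral B n t c \<omega>)\<^sup>2 \<partial>M) < e"
    using k 1 integral_sq_diff_le[OF L2(2) has_wiener_integral_L2(2)[OF wi[of k]] step_integral_L2[OF W 1(1), of c]]
    by linarith
  ultimately show "\<exists>n t c. partition_points T n t \<and>
      (\<integral>s. (h s - step_fun n t c s)\<^sup>2 \<partial>lebesgue_on {0..T}) < e \<and>
      (\<integral>\<omega>. (Y \<omega> - step_integral B n t c \<omega>)\<^sup>2 \<partial>M) < e"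
    using 1(1) by blast
qed

text \<open>The defining property of \<open>B\<close> involves integrals over the varying intervals
  \<open>{0..t}\<close>; comparing them requires a common one. A step function with partition points
  in \<open>{0..t}\<close> vanishes to the right of \<open>t\<close>, so cutting off
  \<open>h\<close> there leaves the approximation error unchanged.\<close>

lemma has_wiener_integral_extend:
  assumes "t \<in> {0..T}" "has_wiener_integral M B t h Y"
  shows "has_wiener_integral M B T (\<lambda>s. h s * indicator {..t} s) Y"
proof -
  have *: "indicator {0..T} s * (G s * indicator {..t} s) = indicator {0..t} s * G s" for G :: "real \<Rightarrow> real" and s
    using assms(1) by (auto simp: indicator_def)
  have meas: "(\<lambda>s. G s * indicator {..t} s) \<in> borel_measurable (lebesgue_on {0..T})"
    if "G \<in> borel_measurable (lebesgue_on {0..t})" for G :: "real \<Rightarrow> real"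
    using that by (simp add: borel_measurable_restrict_space_iff *)
  have int: "integrable (lebesgue_on {0..T}) (\<lambda>s. G s * indicator {..t} s) \<longleftrightarrow>
      integrable (lebesgue_on {0..t}) G" for G :: "real \<Rightarrow> real"
    by (simp add: integrable_restrict_space *)
  have integral: "(\<integral>s. G s * indicator {..t} s \<partial>lebesgue_on {0..T}) = (\<integral>s. G s \<partial>lebesgue_on {0..t})"
    for G :: "real \<Rightarrow> real"
    by (simp add: integral_restrict_space *)
  have sq: "(x * indicator {..t} s)\<^sup>2 = x\<^sup>2 * indicator {..t} s" for x s :: real
    by (simp add: indicator_def)
  have L2: "L2_fun (lebesgue_on {0..T}) (\<lambda>s. h s * indicator {..t} s)"
    using has_wiener_integral_L2(1)[OF assms(2)] by (simp add: L2_fun_def meas sq int)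
  have part: "partition_points T n p" and err:
    "(\<integral>s. (h s * indicator {..t} s - step_fun n p c s)\<^sup>2 \<partial>lebesgue_on {0..T}) =
      (\<integral>s. (h s - step_fun n p c s)\<^sup>2 \<partial>lebesgue_on {0..t})" if "partition_points t n p" for n p c
  proof -
    show "partition_points T n p"
      using that assms(1) by (auto simp: partition_points_def)
    have "step_fun n p c s = step_fun n p c s * indicator {..t} s" for s
    proof (cases "s \<le> t")
      case False
      have "p (Suc i) \<le> t" if "i < n" for i
        using that \<open>partition_points t n p\<close> by (auto simp: partition_points_def image_subset_iff)
      with False show ?thesis
        by (force simp: step_fun_def indicator_def intro!: sum.neutral)
    qed simp
    then have "(h s * indicator {..t} s - step_fun n p c s)\<^sup>2 = (h s - step_fun n p c s)\<^sup>2 * indicator {..t} s" for s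
      by (subst (1) \<open>\<And>s. step_fun n p c s = _\<close>) (simp add: left_diff_distrib[symmetric] sq)
    then show "(\<integral>s. (h s * indicator {..t} s - step_fun n p c s)\<^sup>2 \<partial>lebesgue_on {0..T}) =
      (\<integral>s. (h s - step_fun n p c s)\<^sup>2 \<partial>lebesgue_on {0..t})"
      by (simp add: integral)
  qed
  show ?thesis
    unfolding has_wiener_integral_iff
  proof (intro conjI allI impI L2 has_wiener_integral_L2(2)[OF assms(2)])
    fix e :: real assume "e > 0"
    with assms(2) obtain n p c where *: "partition_points t n p"
      "(\<integral>s. (h s - step_fun n p c s)\<^sup>2 \<partial>lebesgue_on {0..t}) < e"
      "(\<integral>\<omega>. (Y \<omega> - step_integral B n p c \<omega>)\<^sup>2 \<partial>M) < e"
      unfolding has_wiener_integral_iff by blast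
    with part[OF *(1)] err[OF *(1)] show "\<exists>n p c. partition_points T n p \<and>
        (\<integral>s. (h s * indicator {..t} s - step_fun n p c s)\<^sup>2 \<partial>lebesgue_on {0..T}) < e \<and>
        (\<integral>\<omega>. (Y \<omega> - step_integral B n p c \<omega>)\<^sup>2 \<partial>M) < e"
      by (intro exI[of _ n] exI[of _ p] exI[of _ c]) simp
  qed
qed

section \<open>Fractional integrals\<close>

text \<open>The substitution \<open>u = s + (v - s) * t\<close> in the Beta integral on the unit
  interval. The exponents may be negative at both ends, so integrability is a genuine part of the
  claim.\<close>

lemma has_bochner_integral_Beta:
  fixes s v p q :: real
  assumes "p > 0" "q > 0" "s < v"
  shows "has_bochner_integral lborel
    (\<lambda>u. indicator {s<..<v} u * ((u - s) powr (p - 1) * (v - u) powr (q - 1)))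
    ((v - s) powr (p + q - 1) * Beta p q)"
proof -
  have "((\<lambda>t. t powr (p - 1) * (1 - t) powr (q - 1)) has_integral Beta p q) {0<..<1}"
    using has_integral_Beta_real[OF assms(1,2)] by (simp add: has_integral_Icc_iff_Ioo)
  moreover have "Beta p q \<ge> 0"
    using assms by (simp add: Beta_def Gamma_real_pos less_imp_le)
  ultimately have "has_bochner_integral lborel
      (\<lambda>t. indicator {0<..<1} t * (t powr (p - 1) * (1 - t) powr (q - 1))) (Beta p q)"
    by (intro has_bochner_integral_nn_integral nn_integral_has_integral_lebesgue) auto
  then have "has_bochner_integral lborel
      (\<lambda>t. (v - s) powr (p + q - 2) * (indicator {0<..<1} t * (t powr (p - 1) * (1 - t) powr (q - 1))))
      ((v - s) powr (p + q - 2) * Beta p q)"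
    by (rule has_bochner_integral_mult_right)
  moreover have "(v - s) powr (p + q - 2) * (indicator {0<..<1} t * (t powr (p - 1) * (1 - t) powr (q - 1))) =
     indicator {s<..<v} (s + (v - s) * t) *
       ((s + (v - s) * t - s) powr (p - 1) * (v - (s + (v - s) * t)) powr (q - 1))" for t
  proof (cases "t \<in> {0<..<1}")
    case True
    have "v - (s + (v - s) * t) = (v - s) * (1 - t)" "s + (v - s) * t - s = (v - s) * t"
      by (simp_all add: algebra_simps)
    moreover have "(v - s) * t > 0" "(v - s) * (1 - t) > 0"
      using True assms by auto
    ultimately have "s + (v - s) * t \<in> {s<..<v}"
      by (auto simp: algebra_simps)
    moreover have "(v - s) powr (p + q - 2) = (v - s) powr (p - 1) * (v - s) powr (q - 1)"
      by (simp add: powr_add[symmetric])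
    ultimately show ?thesis
      using True assms \<open>v - (s + (v - s) * t) = _\<close>
      by (simp add: powr_mult)
  next
    case False
    then consider "t \<le> 0" | "1 \<le> t" by fastforce
    then have "(v - s) * t \<le> 0 \<or> v - s \<le> (v - s) * t"
      using assms by cases (auto intro: mult_nonneg_nonpos)
    then have "s + (v - s) * t \<notin> {s<..<v}"
      by auto
    with False show ?thesis by simp
  qed
  ultimately have "has_bochner_integral lborel
     (\<lambda>t. indicator {s<..<v} (s + (v - s) * t) *
       ((s + (v - s) * t - s) powr (p - 1) * (v - (s + (v - s) * t)) powr (q - 1)))
     ((v - s) powr (p + q - 2) * Beta p q)"
    by simp
  \<comment> \<open>Splitting off one power of \<open>v - s\<close> exposes the Jacobian factor that
    the affine change of variables expects.\<close>
  also have "(v - s) powr (p + q - 2) = (v - s) powr (p + q - 1) / \<bar>v - s\<bar>"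
    using assms powr_diff[of "v - s" "p + q - 1" 1] by simp
  finally have "has_bochner_integral lborel
     (\<lambda>t. indicator {s<..<v} (s + (v - s) * t) *
       ((s + (v - s) * t - s) powr (p - 1) * (v - (s + (v - s) * t)) powr (q - 1)))
     (((v - s) powr (p + q - 1) * Beta p q) /\<^sub>R \<bar>v - s\<bar>)"
    by (simp add: field_simps)
  then show ?thesis
    using assms by (subst lborel_has_bochner_integral_real_affine_iff[where c="v - s" and t=s]) auto
qed

lemma has_bochner_integral_powr:
  fixes s v a :: real
  assumes "a < 1" "s < v"
  shows "has_bochner_integral lborel (\<lambda>u. indicator {s<..<v} u * (u - s) powr (-a))
    ((v - s) powr (1 - a) / (1 - a))"
proof -
  have "Gamma (2 - a) = (1 - a) * Gamma (1 - a)"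
    using Gamma_plus1[of "1 - a"] assms nonpos_Ints_nonpos[of "1 - a"] by (fastforce simp: algebra_simps)
  moreover have "Gamma (1 - a) > 0"
    using assms by (intro Gamma_real_pos) auto
  ultimately have "Beta (1 - a) 1 = 1 / (1 - a)"
    using assms by (simp add: Beta_def less_imp_neq[symmetric])
  then have "has_bochner_integral lborel
      (\<lambda>u. indicator {s<..<v} u * ((u - s) powr (-a) * (v - u) powr 0)) ((v - s) powr (1 - a) / (1 - a))"
    using has_bochner_integral_Beta[of "1 - a" 1 s v] assms by simp
  moreover have "(\<lambda>u. indicator {s<..<v} u * ((u - s) powr (-a) * (v - u) powr 0)) =
      (\<lambda>u. indicator {s<..<v} u * (u - s) powr (-a))"
    by (auto simp: indicator_def)
  ultimately show ?thesis by (simp only:)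
qed

lemma has_bochner_integral_FTC_Ioo:
  fixes g h :: "real \<Rightarrow> real"
  assumes "s \<le> T" "\<And>x. x \<in> {s..T} \<Longrightarrow> (g has_real_derivative h x) (at x within {s..T})"
    "continuous_on {s..T} h"
  shows "has_bochner_integral lborel (\<lambda>v. indicator {s<..<T} v * h v) (g T - g s)"
proof -
  have "has_bochner_integral lborel (\<lambda>x. indicator {s..T} x *\<^sub>R h x) (g T - g s)"
    using assms by (intro has_bochner_integral_FTC_Icc)
      (auto simp: has_real_derivative_iff_has_vector_derivative[symmetric])
  then show ?thesis
    by (rule has_bochner_integral_discrete_difference[THEN iffD1, of "{s,T}", rotated -1])
      (auto simp: indicator_def)
qed

text \<open>On the triangle \<open>s < u < v < T\<close>, integrating the absolute value over
  \<open>u\<close> first gives \<open>\<bar>h v\<bar> * W v\<close>, because \<open>w\<close> is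
  nonnegative. This is at most \<open>C * D\<close> on a bounded interval, so the product integrand
  is integrable and the order may be exchanged even for singular \<open>w\<close>.\<close>

lemma triangle_Fubini:
  fixes w :: "real \<Rightarrow> real \<Rightarrow> real" and h W :: "real \<Rightarrow> real"
  assumes w [measurable]: "case_prod w \<in> borel_measurable (borel \<Otimes>\<^sub>M borel)"
    and h: "(\<lambda>v. indicator {s<..<T} v * h v) \<in> borel_measurable borel"
    and pos: "\<And>u v. s < u \<Longrightarrow> u < v \<Longrightarrow> v < T \<Longrightarrow> 0 \<le> w u v"
    and W: "\<And>v. v \<in> {s<..<T} \<Longrightarrow> has_bochner_integral lborel (\<lambda>u. indicator {s<..<v} u * w u v) (W v)"
    and C: "\<And>v. v \<in> {s<..<T} \<Longrightarrow> \<bar>h v\<bar> \<le> C" and D: "\<And>v. v \<in> {s<..<T} \<Longrightarrow> W v \<le> D"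
  shows "has_bochner_integral lborel
      (\<lambda>u. indicator {s<..<T} u * (\<integral>v. indicator {u<..<T} v * (w u v * h v) \<partial>lborel))
      (\<integral>v. indicator {s<..<T} v * (h v * W v) \<partial>lborel)"
proof -
  \<comment> \<open>Measurability of \<open>h\<close> is known only after the cutoff. In
    \<open>f\<close> below the triangle is written as a condition on both variables, so that joint
    measurability can be derived; \<open>f_eq\<close> recovers the indicator form.\<close>
  define h' where "h' = (\<lambda>v. indicator {s<..<T} v * h v)"
  have [measurable]: "h' \<in> borel_measurable borel"
    unfolding h'_def by (rule h)
  define f where "f v u = h' v * (if s < u \<and> u < v then w u v else 0)" for v u
  have f_eq: "f v u = h' v * (indicator {s<..<v} u * w u v)" for v u
    by (simp add: f_def indicator_def)
  have [measurable]: "case_prod f \<in> borel_measurable (lborel \<Otimes>\<^sub>M lborel)"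
  proof -
    have [measurable]: "(\<lambda>p. w (snd p) (fst p)) \<in> borel_measurable (borel \<Otimes>\<^sub>M borel)"
      using measurable_compose[OF _ w, of "\<lambda>p. (snd p, fst p)"] by simp
    show ?thesis
      unfolding f_def case_prod_beta by measurable
  qed
  have Wpos: "0 \<le> W v" if "v \<in> {s<..<T}" for v
    unfolding has_bochner_integral_integral_eq[OF W[OF that], symmetric]
    using that pos by (intro integral_nonneg_AE AE_I2) (auto simp: indicator_def)
  have hb: "has_bochner_integral lborel (f v) (h' v * W v)" for v
  proof (cases "v \<in> {s<..<T}")
    case True
    then show ?thesis unfolding f_eq[abs_def] by (intro has_bochner_integral_mult_right W)
  next
    case False
    then show ?thesis by (simp add: f_eq[abs_def] h'_def has_bochner_integral_zero)
  qed
  have abs: "has_bochner_integral lborel (\<lambda>u. norm (f v u)) (\<bar>h' v\<bar> * W v)" for v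
  proof -
    have *: "norm (f v u) = sgn (h' v) * f v u" for u
    proof (cases "v \<in> {s<..<T}")
      case True
      then have "0 \<le> (if s < u \<and> u < v then w u v else 0)"
        using pos by auto
      moreover have "\<bar>x * y\<bar> = sgn x * (x * y)" if "0 \<le> y" for x y :: real
        using that by (cases x "0::real" rule: linorder_cases) (auto simp: abs_mult)
      ultimately show ?thesis
        unfolding f_def real_norm_def by blast
    qed (simp add: f_def h'_def)
    have "has_bochner_integral lborel (\<lambda>u. sgn (h' v) * f v u) (sgn (h' v) * (h' v * W v))"
      by (intro has_bochner_integral_mult_right hb)
    then show ?thesis unfolding * by (simp add: abs_sgn mult_ac)
  qed
  have int: "integrable (lborel \<Otimes>\<^sub>M lborel) (case_prod f)"
  proof (rule lborel_pair.Fubini_integrable)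
    show "integrable lborel (\<lambda>v. \<integral>u. norm (case_prod f (v, u)) \<partial>lborel)"
    proof (rule Bochner_Integration.integrable_bound)
      have "integrable lborel (\<lambda>v. indicator {s<..<T} v :: real)"
        by (cases "s \<le> T") (auto simp: integrable_real_indicator)
      then show "integrable lborel (\<lambda>v. (C * D) * indicator {s<..<T} v)"
        by (rule integrable_mult_right)
      show "AE v in lborel. norm (\<integral>u. norm (case_prod f (v, u)) \<partial>lborel) \<le> norm ((C * D) * indicator {s<..<T} v)"
      proof (rule AE_I2)
        fix v :: real
        have "\<bar>h v\<bar> * W v \<le> \<bar>C\<bar> * \<bar>D\<bar>" if "v \<in> {s<..<T}"
          using C[OF that] D[OF that] Wpos[OF that] by (intro mult_mono) auto
        then show "norm (\<integral>u. norm (case_prod f (v, u)) \<partial>lborel) \<le> norm ((C * D) * indicator {s<..<T} v)"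
          using abs[of v, THEN has_bochner_integral_integral_eq] Wpos[of v]
          by (auto simp: h'_def indicator_def abs_mult)
      qed
    qed measurable
  qed (use hb in \<open>auto simp: has_bochner_integral_iff\<close>)
  have eq: "(\<integral>v. f v u \<partial>lborel) = indicator {s<..<T} u * (\<integral>v. indicator {u<..<T} v * (w u v * h v) \<partial>lborel)" for u
  proof -
    have "f v u = indicator {s<..<T} u * (indicator {u<..<T} v * (w u v * h v))" for v
      by (auto simp: f_def h'_def indicator_def)
    then show ?thesis by simp
  qed
  have "(\<integral>u. (\<integral>v. f v u \<partial>lborel) \<partial>lborel) = (\<integral>v. (\<integral>u. f v u \<partial>lborel) \<partial>lborel)"
    by (rule lborel_pair.Fubini_integral[OF int])
  also have "\<dots> = (\<integral>v. indicator {s<..<T} v * (h v * W v) \<partial>lborel)"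
    using hb[THEN has_bochner_integral_integral_eq] by (simp add: h'_def mult.assoc)
  finally show ?thesis
    using lborel_pair.integrable_snd[OF int] by (simp add: has_bochner_integral_iff eq)
qed

section \<open>The Abel transform and its continuity\<close>

lemma continuous_on_Icc_bounded:
  fixes h :: "real \<Rightarrow> real"
  assumes "continuous_on {s..T} h"
  obtains C where "\<And>x. x \<in> {s..T} \<Longrightarrow> norm (h x) \<le> C"
proof -
  have "bounded (h ` {s..T})"
    by (intro compact_imp_bounded compact_continuous_image assms compact_Icc)
  then obtain C where "\<forall>y\<in>h ` {s..T}. norm y \<le> C"
    unfolding bounded_iff by blast
  then show ?thesis by (intro that[of C]) simp
qed

text \<open>For \<open>a < 1\<close> this is the right-sided Riemann-Liouville fractional integral
  of order \<open>1 - a\<close> on \<open>{s..T}\<close>, without its factor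
  \<open>1 / Gamma (1 - a)\<close>.\<close>

definition abel :: "real \<Rightarrow> real \<Rightarrow> (real \<Rightarrow> real) \<Rightarrow> real \<Rightarrow> real" where
  "abel a T h s = (\<integral>u. indicator {s<..<T} u * ((u - s) powr (-a) * h u) \<partial>lborel)"

lemma borel_measurable_indicator_Ioo:
  fixes h :: "real \<Rightarrow> real"
  assumes "continuous_on {s..T} h"
  shows "(\<lambda>v. indicator {s<..<T} v * h v) \<in> borel_measurable borel"
  using borel_measurable_continuous_on_indicator[of "{s<..<T}" h]
    continuous_on_subset[OF assms, of "{s<..<T}"] by (simp add: greaterThanLessThan_subseteq_atLeastAtMost_iff)

lemma abel_integrable:
  fixes a s T :: real and h :: "real \<Rightarrow> real"
  assumes "a < 1" "continuous_on {s..T} h"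
  shows "integrable lborel (\<lambda>u. indicator {s<..<T} u * ((u - s) powr (-a) * h u))"
proof (cases "s < T")
  case True
  obtain C where C: "\<And>x. x \<in> {s..T} \<Longrightarrow> norm (h x) \<le> C"
    using continuous_on_Icc_bounded[OF assms(2)] by blast
  have [measurable]: "(\<lambda>v. indicator {s<..<T} v * h v) \<in> borel_measurable borel"
    by (rule borel_measurable_indicator_Ioo[OF assms(2)])
  have "(\<lambda>u. (u - s) powr (-a) * (indicator {s<..<T} u * h u)) \<in> borel_measurable borel"
    by measurable
  then have meas: "(\<lambda>u. indicator {s<..<T} u * ((u - s) powr (-a) * h u)) \<in> borel_measurable borel"
    by (simp add: mult_ac)
  show ?thesis
  proof (rule Bochner_Integration.integrable_bound)
    show "integrable lborel (\<lambda>u. C * (indicator {s<..<T} u * (u - s) powr (-a)))"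
      using has_bochner_integral_powr[OF assms(1) True] by (simp add: has_bochner_integral_iff)
    show "AE u in lborel. norm (indicator {s<..<T} u * ((u - s) powr (-a) * h u)) \<le>
        norm (C * (indicator {s<..<T} u * (u - s) powr (-a)))"
    proof (rule AE_I2)
      fix u :: real
      show "norm (indicator {s<..<T} u * ((u - s) powr (-a) * h u)) \<le>
        norm (C * (indicator {s<..<T} u * (u - s) powr (-a)))"
        using C[of u] by (auto simp: indicator_def abs_mult mult.commute intro!: mult_right_mono)
    qed
  qed (use meas in simp)
qed simp

text \<open>Shifts the singularity from the moving point \<open>u = s\<close> to the fixed point
  \<open>w = 0\<close>, so that a single integrable majorant serves all \<open>s\<close> in the
  proof of continuity.\<close>

lemma abel_substitution:
  "abel a T h s = (\<integral>w. indicator {0<..<T - s} w * (w powr (-a) * h (s + w)) \<partial>lborel)"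
  unfolding abel_def
  by (subst lborel_integral_real_affine[where c=1 and t=s])
    (auto intro!: Bochner_Integration.integral_cong simp: indicator_def)

lemma continuous_on_abel:
  assumes "a < 1" "continuous_on {r..T} h"
  shows "continuous_on {r..T} (abel a T h)"
  unfolding continuous_on_sequentially
proof (intro ballI allI impI, elim conjE)
  fix x y assume x: "x \<in> {r..T}" and y: "\<forall>n. y n \<in> {r..T}" and lim: "y \<longlonglongrightarrow> x"
  obtain C where C: "\<And>x. x \<in> {r..T} \<Longrightarrow> norm (h x) \<le> C"
    using continuous_on_Icc_bounded[OF assms(2)] by blast
  define F where "F s w = indicator {0<..<T - s} w * (w powr (-a) * h (s + w))" for s w
  have meas: "F s \<in> borel_measurable borel" if "s \<in> {r..T}" for s
  proof -
    have [measurable]: "(\<lambda>v. indicator {s<..<T} v * h v) \<in> borel_measurable borel"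
      using that by (intro borel_measurable_indicator_Ioo continuous_on_subset[OF assms(2)]) auto
    have "(\<lambda>w. w powr (-a) * (indicator {s<..<T} (s + w) * h (s + w))) \<in> borel_measurable borel"
      using measurable_compose[of "\<lambda>w. s + w" borel borel "\<lambda>v. indicator {s<..<T} v * h v" borel] by simp
    then show ?thesis
      by (rule measurable_cong[THEN iffD1, rotated]) (auto simp: F_def indicator_def)
  qed
  have "(\<lambda>n. \<integral>w. F (y n) w \<partial>lborel) \<longlonglongrightarrow> (\<integral>w. F x w \<partial>lborel)"
  proof (rule integral_dominated_convergence)
    show "integrable lborel (\<lambda>w. C * (indicator {0<..<T - r} w * (w - 0) powr (-a)))"
      using has_bochner_integral_powr[OF assms(1), of 0 "T - r"]
      by (cases "0 < T - r") (simp_all add: has_bochner_integral_iff)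
    show "AE w in lborel. norm (F (y n) w) \<le> C * (indicator {0<..<T - r} w * (w - 0) powr (-a))" for n
    proof (rule AE_I2)
      fix w :: real
      have "0 < w \<Longrightarrow> w < T - y n \<Longrightarrow> norm (h (y n + w)) \<le> C"
        using y[rule_format, of n] by (intro C) auto
      then show "norm (F (y n) w) \<le> C * (indicator {0<..<T - r} w * (w - 0) powr (-a))"
        using y[rule_format, of n] C[OF x]
        by (auto simp: F_def indicator_def abs_mult mult.commute intro!: mult_right_mono mult_nonneg_nonneg)
    qed
    \<comment> \<open>Pointwise convergence can fail only where the limiting indicator jumps at its
      upper end.\<close>
    have "AE w in lborel. w \<noteq> T - x"
      by (rule AE_lborel_singleton)
    then show "AE w in lborel. (\<lambda>n. F (y n) w) \<longlonglongrightarrow> F x w"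
    proof eventually_elim
      case (elim w)
      consider "w \<le> 0" | "w > T - x" | "0 < w" "w < T - x"
        using elim by linarith
      then show ?case
      proof cases
        case 1
        then show ?thesis by (simp add: F_def)
      next
        case 2
        have "(\<lambda>n. T - y n) \<longlonglongrightarrow> T - x"
          by (intro tendsto_intros lim)
        from order_tendstoD(2)[OF this 2] have "\<forall>\<^sub>F n in sequentially. F (y n) w = F x w"
          by eventually_elim (use 2 in \<open>simp add: F_def\<close>)
        then show ?thesis by (rule tendsto_eventually)
      next
        case 3
        have *: "(\<lambda>n. T - y n) \<longlonglongrightarrow> T - x"
          by (intro tendsto_intros lim)
        have ev: "\<forall>\<^sub>F n in sequentially. w < T - y n"
          by (rule order_tendstoD(1)[OF * 3(2)])
        have "(\<lambda>n. h (y n + w)) \<longlonglongrightarrow> h (x + w)"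
        proof (rule continuous_on_tendsto_compose[OF assms(2)])
          show "(\<lambda>n. y n + w) \<longlonglongrightarrow> x + w"
            by (intro tendsto_intros lim)
          show "x + w \<in> {r..T}" using x 3 by auto
          show "\<forall>\<^sub>F n in sequentially. y n + w \<in> {r..T}"
            using ev by eventually_elim (use y 3 in \<open>auto intro: add_increasing2\<close>)
        qed
        then have "(\<lambda>n. w powr (-a) * h (y n + w)) \<longlonglongrightarrow> w powr (-a) * h (x + w)"
          by (intro tendsto_intros)
        moreover have "\<forall>\<^sub>F n in sequentially. F (y n) w = w powr (-a) * h (y n + w)"
          using ev by eventually_elim (use 3 in \<open>simp add: F_def\<close>)
        ultimately have "(\<lambda>n. F (y n) w) \<longlonglongrightarrow> w powr (-a) * h (x + w)"
          using Lim_transform_eventually[of _ _ sequentially] by (simp add: eq_commute tendsto_cong)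
        then show ?thesis using 3 by (simp add: F_def)
      qed
    qed
  qed (use x y meas in auto)
  then show "((abel a T h) \<circ> y) \<longlonglongrightarrow> abel a T h x"
    by (simp add: abel_substitution F_def o_def)
qed


section \<open>Fractional integration by parts and Abel inversion\<close>

context
  fixes a T r :: real and g h :: "real \<Rightarrow> real"
  assumes a: "0 < a" "a < 1"
    and g: "\<And>x. x \<in> {r..T} \<Longrightarrow> (g has_real_derivative h x) (at x within {r..T})"
    and h: "continuous_on {r..T} h"
begin

lemma FTC_subinterval:
  assumes "r \<le> s" "s \<le> T"
  shows "has_bochner_integral lborel (\<lambda>v. indicator {s<..<T} v * h v) (g T - g s)"
  using assms h g by (intro has_bochner_integral_FTC_Ioo)
    (auto intro: continuous_on_subset DERIV_subset[of g _ _ "{r..T}"])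

lemma continuous_on_g: "continuous_on {r..T} g"
  using g by (intro DERIV_continuous_on)

lemma triangle_abel:
  assumes s: "r \<le> s" "s < T"
    and w: "case_prod w \<in> borel_measurable (borel \<Otimes>\<^sub>M borel)"
    and pos: "\<And>u v. s < u \<Longrightarrow> u < v \<Longrightarrow> v < T \<Longrightarrow> 0 \<le> w u v"
    and W: "\<And>v. v \<in> {s<..<T} \<Longrightarrow> has_bochner_integral lborel (\<lambda>u. indicator {s<..<v} u * w u v) (W v)"
    and D: "\<And>v. v \<in> {s<..<T} \<Longrightarrow> W v \<le> D"
  shows "has_bochner_integral lborel
      (\<lambda>u. indicator {s<..<T} u * (\<integral>v. indicator {u<..<T} v * (w u v * h v) \<partial>lborel))
      (\<integral>v. indicator {s<..<T} v * (h v * W v) \<partial>lborel)"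
proof -
  obtain C where C: "\<And>x. x \<in> {r..T} \<Longrightarrow> norm (h x) \<le> C"
    using continuous_on_Icc_bounded[OF h] by blast
  show ?thesis
  proof (rule triangle_Fubini[OF w _ pos W _ D])
    show "(\<lambda>v. indicator {s<..<T} v * h v) \<in> borel_measurable borel"
      using s by (intro borel_measurable_indicator_Ioo continuous_on_subset[OF h]) auto
    show "\<bar>h v\<bar> \<le> C" if "v \<in> {s<..<T}" for v
      using C[of v] s that by auto
  qed auto
qed

text \<open>The weights \<open>(v - u) powr (-a)\<close> and \<open>(u - s) powr (-a)\<close> have
  the same integral \<open>W v\<close> over \<open>{s<..<v}\<close>, so two applications of Fubini
  on the triangle lead to the same integral of \<open>h * W\<close>. With the first weight the inner
  integral is \<open>abel a T h u\<close>; with the second it is elementary, because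
  \<open>h\<close> integrates to \<open>g T - g u\<close>. Solved for \<open>abel a T g\<close>, the
  identity exhibits it as an explicit function minus a primitive, hence as differentiable.\<close>

lemma abel_eq_integral_abel:
  assumes s: "r \<le> s" "s < T"
  shows "has_bochner_integral lborel (\<lambda>u. indicator {s<..<T} u * abel a T h u)
    (g T * ((T - s) powr (1 - a) / (1 - a)) - abel a T g s)"
proof -
  define W where "W v = (v - s) powr (1 - a) / (1 - a)" for v
  have D: "W v \<le> W T" if "v \<in> {s<..<T}" for v
    using that a by (auto simp: W_def intro!: divide_right_mono powr_mono2)
  have W: "has_bochner_integral lborel (\<lambda>u. indicator {s<..<v} u * (u - s) powr (-a)) (W v)"
    if "v > s" for v
    unfolding W_def using that a by (intro has_bochner_integral_powr)
  \<comment> \<open>The reflection \<open>u\<close> to \<open>s + v - u\<close> of the interval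
    exchanges the two weights.\<close>
  have W': "has_bochner_integral lborel (\<lambda>u. indicator {s<..<v} u * (v - u) powr (-a)) (W v)"
    if "v > s" for v
  proof -
    have "has_bochner_integral lborel
        (\<lambda>u. indicator {s<..<v} (s + v + (-1) * u) * (s + v + (-1) * u - s) powr (-a)) (W v /\<^sub>R \<bar>-1\<bar>)"
      by (subst lborel_has_bochner_integral_real_affine_iff[symmetric]) (simp_all add: W that)
    moreover have "(\<lambda>u. indicator {s<..<v} (s + v + (-1) * u) * (s + v + (-1) * u - s) powr (-a)) =
        (\<lambda>u. indicator {s<..<v} u * (v - u) powr (-a))"
      by (auto simp: indicator_def)
    ultimately show ?thesis by (simp only:) simp
  qed
  have 1: "has_bochner_integral lborel
      (\<lambda>u. indicator {s<..<T} u * (\<integral>v. indicator {u<..<T} v * ((v - u) powr (-a) * h v) \<partial>lborel))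
      (\<integral>v. indicator {s<..<T} v * (h v * W v) \<partial>lborel)"
    using W' by (intro triangle_abel[OF s _ _ _ D]) auto
  have 2: "has_bochner_integral lborel
      (\<lambda>u. indicator {s<..<T} u * (\<integral>v. indicator {u<..<T} v * ((u - s) powr (-a) * h v) \<partial>lborel))
      (\<integral>v. indicator {s<..<T} v * (h v * W v) \<partial>lborel)"
    using W by (intro triangle_abel[OF s _ _ _ D]) auto
  have eq: "indicator {s<..<T} u * (\<integral>v. indicator {u<..<T} v * ((u - s) powr (-a) * h v) \<partial>lborel) =
      g T * (indicator {s<..<T} u * (u - s) powr (-a)) - indicator {s<..<T} u * ((u - s) powr (-a) * g u)" for u
  proof (cases "u \<in> {s<..<T}")
    case True
    then have "(\<integral>v. (u - s) powr (-a) * (indicator {u<..<T} v * h v) \<partial>lborel) = (u - s) powr (-a) * (g T - g u)"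
      using FTC_subinterval[of u] s by (simp add: has_bochner_integral_iff)
    then show ?thesis
      using True by (simp add: mult.left_commute algebra_simps)
  qed simp
  have "has_bochner_integral lborel
      (\<lambda>u. g T * (indicator {s<..<T} u * (u - s) powr (-a)) - indicator {s<..<T} u * ((u - s) powr (-a) * g u))
      (g T * W T - abel a T g s)"
    unfolding abel_def using s a continuous_on_subset[OF continuous_on_g]
    by (intro has_bochner_integral_diff has_bochner_integral_mult_right W has_bochner_integral_integrable abel_integrable) auto
  from has_bochner_integral_eq[OF 2[unfolded eq] this] 1 show ?thesis
    by (simp add: abel_def W_def)
qed

lemma abel_has_real_derivative:
  assumes s: "r < s" "s < T"
  shows "(abel a T g has_real_derivative (- ((T - s) powr (-a) * g T) + abel a T h s)) (at s)"
proof -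
  define A where "A = abel a T h"
  have cont: "continuous_on {r..T} A"
    unfolding A_def by (rule continuous_on_abel[OF a(2) h])
  have "((\<lambda>x. integral {x..T} A) has_real_derivative - A s) (at s within {r..T})"
    using s by (intro integral_has_real_derivative' cont) auto
  then have 1: "((\<lambda>x. integral {x..T} A) has_real_derivative - A s) (at s)"
    using s at_within_Icc_at[of r s T] by simp
  have eq: "abel a T g x = g T * ((T - x) powr (1 - a) / (1 - a)) - integral {x..T} A" if "x \<in> {r<..<T}" for x
  proof -
    have "(\<lambda>u. indicator {x<..<T} u * A u) = (\<lambda>u. indicator {x<..<T} u *\<^sub>R A u)" by simp
    then have "set_integrable lborel {x<..<T} A" "(LINT u:{x<..<T}|lborel. A u) = g T * ((T - x) powr (1 - a) / (1 - a)) - abel a T g x"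
      using abel_eq_integral_abel[of x] that
      by (auto simp: has_bochner_integral_iff set_integrable_def set_lebesgue_integral_def A_def)
    moreover from this(1) have "(LINT u:{x<..<T}|lborel. A u) = integral {x<..<T} A"
      by (rule set_borel_integral_eq_integral)
    moreover have "integral {x<..<T} A = integral {x..T} A"
      by (simp add: integral_open_interval_real)
    ultimately show ?thesis by simp
  qed
  have "((\<lambda>x. T - x) has_real_derivative -1) (at s)"
    by (auto intro!: derivative_eq_intros)
  from DERIV_fun_powr[OF this, of "1 - a"] s
  have "((\<lambda>x. (T - x) powr (1 - a)) has_real_derivative (1 - a) * - ((T - s) powr (-a))) (at s)"
    by simp
  from DERIV_cmult[OF DERIV_cdivide[OF this, of "1 - a"], of "g T"] a
  have "((\<lambda>x. g T * ((T - x) powr (1 - a) / (1 - a))) has_real_derivative - ((T - s) powr (-a) * g T)) (at s)"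
    by (simp add: mult_ac)
  from DERIV_diff[OF this 1]
  have "((\<lambda>x. g T * ((T - x) powr (1 - a) / (1 - a)) - integral {x..T} A) has_real_derivative
      - ((T - s) powr (-a) * g T) + A s) (at s)"
    by simp
  then show ?thesis
    unfolding A_def[symmetric]
  proof (rule DERIV_cong_ev[THEN iffD1, rotated 3])
    have "\<forall>\<^sub>F x in nhds s. x \<in> {r<..<T}"
      using s by (intro eventually_nhds_in_open) auto
    then show "\<forall>\<^sub>F x in nhds s. g T * ((T - x) powr (1 - a) / (1 - a)) - integral {x..T} A = abel a T g x"
      by eventually_elim (simp add: eq)
  qed auto
qed

text \<open>The last factor in the integrand is minus the derivative of \<open>abel a T g\<close>.
  After Fubini the inner integral of \<open>(u - t) powr (a - 1) * (v - u) powr (-a)\<close> is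
  \<open>Beta a (1 - a)\<close> for every \<open>v\<close>, so the double integral is that constant
  times \<open>g T - g t\<close>, and the boundary term contributes it times
  \<open>g T\<close>.\<close>

lemma abel_inversion:
  assumes t: "r \<le> t" "t < T"
  shows "(\<integral>u. indicator {t<..<T} u * ((u - t) powr (a - 1) * ((T - u) powr (-a) * g T - abel a T h u)) \<partial>lborel)
    = Beta a (1 - a) * g t"
proof -
  have B: "has_bochner_integral lborel (\<lambda>u. indicator {t<..<v} u * ((u - t) powr (a - 1) * (v - u) powr (-a))) (Beta a (1 - a))"
    if "v > t" for v
    using has_bochner_integral_Beta[of a "1 - a" t v] that a by simp
  have "has_bochner_integral lborel
      (\<lambda>u. indicator {t<..<T} u * (\<integral>v. indicator {u<..<T} v * ((u - t) powr (a - 1) * (v - u) powr (-a) * h v) \<partial>lborel))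
      (\<integral>v. indicator {t<..<T} v * (h v * Beta a (1 - a)) \<partial>lborel)"
    using B by (intro triangle_abel[OF t, where D="Beta a (1 - a)"]) auto
  moreover have "(\<integral>v. indicator {u<..<T} v * ((u - t) powr (a - 1) * (v - u) powr (-a) * h v) \<partial>lborel) =
      (u - t) powr (a - 1) * abel a T h u" for u
    by (simp add: abel_def mult_ac flip: integral_mult_right_zero)
  moreover have "(\<integral>v. indicator {t<..<T} v * (h v * Beta a (1 - a)) \<partial>lborel) = (g T - g t) * Beta a (1 - a)"
    using FTC_subinterval[of t] t by (simp add: has_bochner_integral_iff flip: mult.assoc)
  ultimately have "has_bochner_integral lborel (\<lambda>u. g T * (indicator {t<..<T} u * ((u - t) powr (a - 1) * (T - u) powr (-a)))
      - indicator {t<..<T} u * ((u - t) powr (a - 1) * abel a T h u))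
      (g T * Beta a (1 - a) - (g T - g t) * Beta a (1 - a))"
    using t by (intro has_bochner_integral_diff has_bochner_integral_mult_right B) auto
  then show ?thesis
    by (simp add: has_bochner_integral_iff algebra_simps)
qed

end

section \<open>The kernel of fractional Brownian motion\<close>

text \<open>Passes from the completed measure and closed interval of the definitions to
  \<open>lborel\<close> and an open interval; the end points are null.\<close>

lemma set_integral_lebesgue_Icc:
  fixes F :: "real \<Rightarrow> real"
  assumes "(\<lambda>u. indicator {v<..<T} u * F u) \<in> borel_measurable borel"
  shows "(LINT u:{v..T}|lebesgue. F u) = (\<integral>u. indicator {v<..<T} u * F u \<partial>lborel)"
proof -
  have "(LINT u:{v..T}|lebesgue. F u) = (\<integral>u. indicator {v<..<T} u * F u \<partial>lebesgue)"
    unfolding set_lebesgue_integral_def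
    by (rule integral_discrete_difference[of "{v, T}"]) (auto simp: indicator_def)
  also have "\<dots> = (\<integral>u. indicator {v<..<T} u * F u \<partial>lborel)"
    by (rule integral_completion) (use assms in simp)
  finally show ?thesis .
qed

definition fbm_g :: "real \<Rightarrow> (real \<Rightarrow> real) \<Rightarrow> real \<Rightarrow> real" where
  "fbm_g a f u = u powr (-a) * f u"

text \<open>The derivative of \<open>fbm_g a f\<close> away from the origin, when \<open>f'\<close>
  is that of \<open>f\<close>.\<close>

definition fbm_h :: "real \<Rightarrow> (real \<Rightarrow> real) \<Rightarrow> (real \<Rightarrow> real) \<Rightarrow> real \<Rightarrow> real" where
  "fbm_h a f f' u = u powr (-a) * f' u - a * (u powr (-a-1) * f u)"

text \<open>Up to a constant, the classical Volterra (Molchan-Golosov) kernel of fractional Brownian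
  motion for \<open>H < 1/2\<close>, with \<open>a = 1/2 - H\<close>. It arises from
  \<open>fbm_K\<close> with horizon \<open>t\<close> and the constant function 1, for which
  \<open>fbm_h\<close> reduces to \<open>- a * u powr (-a-1)\<close>.\<close>

definition fbm_kernel :: "real \<Rightarrow> real \<Rightarrow> real \<Rightarrow> real" where
  "fbm_kernel a t s = (if 0 < s \<and> s < t
     then s powr a * ((t - s) powr (-a) * t powr (-a) + a * abel a t (\<lambda>u. u powr (-a-1)) s) else 0)"

lemma borel_measurable_fbm_kernel:
  "(\<lambda>(t, s). fbm_kernel a t s) \<in> borel_measurable (borel \<Otimes>\<^sub>M borel)"
proof -
  have "(\<lambda>(t, s). \<integral>u. (if s < u \<and> u < t then 1 else 0) * ((u - s) powr (-a) * u powr (-a-1)) \<partial>lborel)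
      \<in> borel_measurable (borel \<Otimes>\<^sub>M borel)"
    by measurable
  moreover have "abel a t (\<lambda>u. u powr (-a-1)) s =
      (\<integral>u. (if s < u \<and> u < t then 1 else 0) * ((u - s) powr (-a) * u powr (-a-1)) \<partial>lborel)" for t s
    unfolding abel_def by (intro Bochner_Integration.integral_cong refl) (simp add: indicator_def)
  ultimately have [measurable]: "(\<lambda>p. abel a (fst p) (\<lambda>u. u powr (-a-1)) (snd p)) \<in> borel_measurable (borel \<Otimes>\<^sub>M borel)"
    by (simp add: case_prod_beta)
  show ?thesis
    unfolding fbm_kernel_def case_prod_beta by measurable
qed

section \<open>The operators \<open>fbm_K\<close> and \<open>fbm_K_star\<close> on continuously
  differentiable functions\<close>

context
  fixes H a :: real
  assumes H: "0 < H" "H < 1/2" and a_def: "a = 1/2 - H"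
begin

lemma a_bounds: "0 < a" "a < 1/2"
  using H by (auto simp: a_def)

lemma fbm_exponents: "H - 1/2 = -a" "1/2 - H = a" "-1/2 - H = a - 1" "H + 1/2 = 1 - a"
  by (auto simp: a_def)

context
  fixes T :: real and f f' :: "real \<Rightarrow> real"
  assumes T: "0 < T"
    and f: "\<And>t. t \<in> {0..T} \<Longrightarrow> (f has_real_derivative f' t) (at t within {0..T})"
    and f': "continuous_on {0..T} f'"
begin

lemma continuous_on_f: "continuous_on {0..T} f"
  using f by (intro DERIV_continuous_on)

lemma fbm_g_has_derivative:
  assumes "0 < r" "x \<in> {r..T}"
  shows "(fbm_g a f has_real_derivative fbm_h a f f' x) (at x within {r..T})"
proof -
  have "x > 0" using assms by auto
  then have 1: "((\<lambda>u. u powr (-a)) has_real_derivative (-a) * x powr (-a-1)) (at x within {r..T})"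
    by (rule has_field_derivative_at_within[OF has_real_derivative_powr])
  have 2: "(f has_real_derivative f' x) (at x within {r..T})"
    using assms by (intro DERIV_subset[OF f]) auto
  from DERIV_mult[OF 1 2] show ?thesis
    unfolding fbm_g_def[abs_def] fbm_h_def by (simp add: algebra_simps)
qed

lemma continuous_on_fbm_h:
  assumes "0 < r"
  shows "continuous_on {r..T} (fbm_h a f f')"
  unfolding fbm_h_def[abs_def] using assms
  by (intro continuous_intros continuous_on_subset[OF continuous_on_f] continuous_on_subset[OF f']) auto

lemma fbm_K_integral_eq_abel:
  assumes "0 < v"
  shows "(LINT u:{v..T}|lebesgue. (u - v) powr (H - 1/2) * u powr (H - 1/2) * f u) = abel a T (fbm_g a f) v"
proof -
  have "continuous_on {v..T} (fbm_g a f)"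
    unfolding fbm_g_def[abs_def] using assms
    by (intro continuous_intros continuous_on_subset[OF continuous_on_f]) auto
  from abel_integrable[OF _ this, of a] a_bounds
  have "integrable lborel (\<lambda>u. indicator {v<..<T} u * ((u - v) powr (-a) * u powr (-a) * f u))"
    by (simp add: fbm_g_def mult.assoc)
  then show ?thesis
    unfolding fbm_exponents
    by (subst set_integral_lebesgue_Icc) (auto simp: abel_def fbm_g_def mult.assoc)
qed

lemma fbm_K_eq_abel:
  assumes "0 < s" "s < T"
  shows "fbm_K H T f s = fbm_C1 H / Gamma (H + 1/2) *
    (s powr a * ((T - s) powr (-a) * fbm_g a f T - abel a T (fbm_h a f f') s))"
proof -
  \<comment> \<open>The fractional calculus is invoked on \<open>{s/2..T}\<close>; any left end
    strictly between \<open>0\<close> and \<open>s\<close> keeps away from the singular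
    weight.\<close>
  have "(abel a T (fbm_g a f) has_real_derivative
      - ((T - s) powr (-a) * fbm_g a f T) + abel a T (fbm_h a f f') s) (at s)"
    using assms a_bounds
    by (intro abel_has_real_derivative[where r="s/2"] fbm_g_has_derivative continuous_on_fbm_h) auto
  moreover have "\<forall>\<^sub>F v in nhds s. v \<in> {0<..}"
    using assms by (intro eventually_nhds_in_open) auto
  then have "\<forall>\<^sub>F v in nhds s. (LINT u:{v..T}|lebesgue. (u - v) powr (H - 1/2) * u powr (H - 1/2) * f u) =
      abel a T (fbm_g a f) v"
    by eventually_elim (rule fbm_K_integral_eq_abel, simp)
  then have "deriv (\<lambda>v. LINT u:{v..T}|lebesgue. (u - v) powr (H - 1/2) * u powr (H - 1/2) * f u) s =
      deriv (abel a T (fbm_g a f)) s"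
    by (rule deriv_cong_ev) simp
  ultimately have deriv: "deriv (\<lambda>v. LINT u:{v..T}|lebesgue. (u - v) powr (H - 1/2) * u powr (H - 1/2) * f u) s =
      - ((T - s) powr (-a) * fbm_g a f T) + abel a T (fbm_h a f f') s"
    by (simp only: DERIV_imp_deriv)
  have "- (c * p / q) * (- x + y) = c / q * (p * (x - y))" for c p q x y :: real
    by (simp add: algebra_simps diff_divide_distrib)
  then show ?thesis
    unfolding fbm_K_def deriv unfolding fbm_exponents .
qed

lemma fbm_C1_pos: "fbm_C1 H > 0"
  unfolding fbm_C1_def using H by (intro real_sqrt_gt_zero divide_pos_pos mult_pos_pos Gamma_real_pos) auto

text \<open>Composition in this order is what membership in the class of integrands requires: it
  shows that \<open>fbm_K H T f\<close> is a preimage of \<open>f\<close>. The weights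
  \<open>u powr a\<close> and \<open>u powr (-a)\<close> cancel, leaving the Abel inversion of
  \<open>fbm_g a f\<close>.\<close>

lemma fbm_K_star_fbm_K:
  assumes "0 < t" "t < T"
  shows "fbm_K_star H T (fbm_K H T f) t = f t"
proof -
  define c where "c = fbm_C1 H / Gamma (H + 1/2)"
  define D where "D u = (T - u) powr (-a) * fbm_g a f T - abel a T (fbm_h a f f') u" for u
  have eq: "indicator {t<..<T} u * ((u - t) powr (- 1/2 - H) * u powr (H - 1/2) * fbm_K H T f u) =
      c * (indicator {t<..<T} u * ((u - t) powr (a - 1) * D u))" for u
  proof (cases "u \<in> {t<..<T}")
    case True
    then have "fbm_K H T f u = c * (u powr a * D u)"
      using assms fbm_K_eq_abel[of u] by (simp add: c_def D_def)
    moreover have "u powr (-a) * u powr a = 1"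
      using True assms by (simp add: powr_add[symmetric])
    ultimately show ?thesis
      unfolding fbm_exponents by (simp add: mult_ac)
  qed simp
  have "(\<lambda>v. indicator {t<..<T} v * abel a T (fbm_h a f f') v) \<in> borel_measurable borel"
    using assms a_bounds by (intro borel_measurable_indicator_Ioo continuous_on_abel continuous_on_fbm_h) auto
  then have "(\<lambda>u. (u - t) powr (a - 1) * (indicator {t<..<T} u * ((T - u) powr (-a) * fbm_g a f T) -
      indicator {t<..<T} u * abel a T (fbm_h a f f') u)) \<in> borel_measurable borel"
    by measurable
  then have meas: "(\<lambda>u. indicator {t<..<T} u * ((u - t) powr (a - 1) * D u)) \<in> borel_measurable borel"
    by (rule measurable_cong[THEN iffD1, rotated]) (auto simp: D_def indicator_def)
  have meas': "(\<lambda>u. indicator {t<..<T} u * ((u - t) powr (- 1/2 - H) * u powr (H - 1/2) * fbm_K H T f u))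
      \<in> borel_measurable borel"
    unfolding eq by (intro borel_measurable_times borel_measurable_const meas)
  have "(LINT u:{t..T}|lebesgue. (u - t) powr (- 1/2 - H) * u powr (H - 1/2) * fbm_K H T f u) =
      (\<integral>u. c * (indicator {t<..<T} u * ((u - t) powr (a - 1) * D u)) \<partial>lborel)"
    unfolding set_integral_lebesgue_Icc[OF meas'] eq ..
  also have "\<dots> = c * (Beta a (1 - a) * fbm_g a f t)"
    using abel_inversion[of a t T "fbm_g a f" "fbm_h a f f'" t] assms a_bounds
      fbm_g_has_derivative[of t] continuous_on_fbm_h[of t]
    by (simp add: D_def)
  finally have "fbm_K_star H T (fbm_K H T f) t =
      inverse (fbm_C1 H) * t powr a / Gamma a * (c * (Beta a (1 - a) * fbm_g a f t))"
    unfolding fbm_K_star_def fbm_exponents by simp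
  also have "\<dots> = t powr a * t powr (-a) * f t"
  proof -
    have pos: "Gamma a > 0" "Gamma (1 - a) > 0"
      using a_bounds by (auto intro: Gamma_real_pos)
    have "inverse C * x / p * (C / q * (p * q * (y * z))) = x * y * z"
      if "C > 0" "p > 0" "q > 0" for C p q x y z :: real
      using that by simp
    \<comment> \<open>The Beta constant cancels against the normalizations of the two operators:
      \<open>Gamma a\<close> stems from \<open>fbm_K_star\<close>, and
      \<open>Gamma (1 - a) = Gamma (H + 1/2)\<close> from \<open>fbm_K\<close>.\<close>
    moreover have "Beta a (1 - a) = Gamma a * Gamma (1 - a)"
      by (simp add: Beta_def)
    ultimately show ?thesis
      unfolding c_def fbm_exponents fbm_g_def using fbm_C1_pos pos by (simp only:)
  qed
  also have "\<dots> = f t"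
    using assms by (simp add: powr_add[symmetric])
  finally show ?thesis .
qed

text \<open>With \<open>P\<close> the integral term of the kernel, Fubini turns the integral of
  \<open>f' * P\<close> into \<open>f T * P T\<close> minus the Abel transform of
  \<open>u powr (-a-1) * f u\<close>. That transform is exactly the part of
  \<open>abel a T (fbm_h a f f')\<close> in which the weight is differentiated; the other part, with
  \<open>f'\<close>, is matched by the first term of the kernel.\<close>

lemma fbm_K_eq_kernel:
  assumes s: "0 < s" "s < T"
  shows "fbm_K H T f s = fbm_C1 H / Gamma (H + 1/2) *
      (f T * fbm_kernel a T s - (\<integral>t. indicator {s<..<T} t * (f' t * fbm_kernel a t s) \<partial>lborel))"
    and "integrable lborel (\<lambda>t. indicator {s<..<T} t * (f' t * fbm_kernel a t s))"
proof -
  note a = a_bounds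
  define w where "w u = (u - s) powr (-a) * u powr (-a-1)" for u
  define P where "P v = abel a v (\<lambda>u. u powr (-a-1)) s" for v
  have cont: "continuous_on {s..v} (\<lambda>u. u powr (-a-1))" for v
    using s by (intro continuous_intros) auto
  have P: "has_bochner_integral lborel (\<lambda>u. indicator {s<..<v} u * w u) (P v)" for v
    using abel_integrable[OF _ cont] a by (simp add: P_def abel_def w_def has_bochner_integral_iff)
  have P_pos: "0 \<le> P v" for v
    unfolding has_bochner_integral_integral_eq[OF P, symmetric] by (simp add: w_def)
  have P_mono: "P v \<le> P T" if "v < T" for v
    unfolding has_bochner_integral_integral_eq[OF P, symmetric]
    using P that by (intro integral_mono) (auto simp: has_bochner_integral_iff indicator_def w_def)
  obtain C where C: "\<And>x. x \<in> {0..T} \<Longrightarrow> norm (f' x) \<le> C"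
    using continuous_on_Icc_bounded[OF f'] by blast
  have f'_meas: "(\<lambda>v. indicator {s<..<T} v * f' v) \<in> borel_measurable borel"
    using s by (intro borel_measurable_indicator_Ioo continuous_on_subset[OF f']) auto
  have "has_bochner_integral lborel
      (\<lambda>u. indicator {s<..<T} u * (\<integral>v. indicator {u<..<T} v * (w u * f' v) \<partial>lborel))
      (\<integral>v. indicator {s<..<T} v * (f' v * P v) \<partial>lborel)"
  proof (rule triangle_Fubini[OF _ f'_meas _ P])
    show "\<bar>f' v\<bar> \<le> C" if "v \<in> {s<..<T}" for v
      using C[of v] that s by auto
    show "P v \<le> P T" if "v \<in> {s<..<T}" for v
      using P_mono that by auto
  qed (auto simp: w_def[abs_def])
  moreover have "indicator {s<..<T} u * (\<integral>v. indicator {u<..<T} v * (w u * f' v) \<partial>lborel) =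
      f T * (indicator {s<..<T} u * w u) - indicator {s<..<T} u * ((u - s) powr (-a) * (u powr (-a-1) * f u))" for u
  proof (cases "u \<in> {s<..<T}")
    case True
    have "has_bochner_integral lborel (\<lambda>v. indicator {u<..<T} v * f' v) (f T - f u)"
      using True s f by (intro has_bochner_integral_FTC_Ioo continuous_on_subset[OF f'])
        (auto intro: DERIV_subset[of f _ _ "{0..T}"])
    then have "(\<integral>v. w u * (indicator {u<..<T} v * f' v) \<partial>lborel) = w u * (f T - f u)"
      by (simp add: has_bochner_integral_iff)
    with True show ?thesis
      by (simp add: mult.left_commute w_def algebra_simps)
  qed simp
  ultimately have 1: "has_bochner_integral lborel
      (\<lambda>u. f T * (indicator {s<..<T} u * w u) - indicator {s<..<T} u * ((u - s) powr (-a) * (u powr (-a-1) * f u)))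
      (\<integral>v. indicator {s<..<T} v * (f' v * P v) \<partial>lborel)"
    by simp
  have cont1: "continuous_on {s..T} (\<lambda>u. u powr (-a-1) * f u)" "continuous_on {s..T} (\<lambda>u. u powr (-a) * f' u)"
    using s by (intro continuous_intros continuous_on_subset[OF continuous_on_f] continuous_on_subset[OF f']; auto)+
  have int1: "integrable lborel (\<lambda>u. indicator {s<..<T} u * ((u - s) powr (-a) * (u powr (-a-1) * f u)))"
    and int2: "integrable lborel (\<lambda>u. indicator {s<..<T} u * ((u - s) powr (-a) * (u powr (-a) * f' u)))"
    using a by (auto intro!: abel_integrable cont1)
  have I1: "(\<integral>v. indicator {s<..<T} v * (f' v * P v) \<partial>lborel) = f T * P T - abel a T (\<lambda>u. u powr (-a-1) * f u) s"
    using has_bochner_integral_integral_eq[OF 1] P int1 by (simp add: abel_def has_bochner_integral_iff)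
  have I2: "abel a T (fbm_h a f f') s = abel a T (\<lambda>u. u powr (-a) * f' u) s - a * abel a T (\<lambda>u. u powr (-a-1) * f u) s"
  proof -
    have "indicator {s<..<T} u * ((u - s) powr (-a) * fbm_h a f f' u) =
       indicator {s<..<T} u * ((u - s) powr (-a) * (u powr (-a) * f' u)) -
       a * (indicator {s<..<T} u * ((u - s) powr (-a) * (u powr (-a-1) * f u)))" for u
      by (simp add: fbm_h_def algebra_simps)
    then show ?thesis
      unfolding abel_def using int1 int2 by simp
  qed
  have kernel: "fbm_kernel a t s = s powr a * ((t - s) powr (-a) * t powr (-a) + a * P t)" if "s < t" for t
    using that s by (simp add: fbm_kernel_def P_def)
  have int3: "integrable lborel (\<lambda>v. indicator {s<..<T} v * (f' v * P v))"
  proof (rule Bochner_Integration.integrable_bound)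
    show "integrable lborel (\<lambda>v. (C * P T) * indicator {s<..<T} v)"
      using s by (intro integrable_mult_right) (auto simp: integrable_real_indicator)
    have "(\<lambda>v. \<integral>u. (if s < u \<and> u < v then 1 else 0) * w u \<partial>lborel) \<in> borel_measurable borel"
      unfolding w_def by measurable
    moreover have "P = (\<lambda>v. \<integral>u. (if s < u \<and> u < v then 1 else 0) * w u \<partial>lborel)"
    proof
      fix v
      show "P v = (\<integral>u. (if s < u \<and> u < v then 1 else 0) * w u \<partial>lborel)"
        unfolding has_bochner_integral_integral_eq[OF P, symmetric]
        by (intro Bochner_Integration.integral_cong refl) (simp add: indicator_def)
    qed
    ultimately have P_meas: "P \<in> borel_measurable borel"
      by (simp only:)
    have "(\<lambda>v. (indicator {s<..<T} v * f' v) * P v) \<in> borel_measurable borel"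
      by (intro borel_measurable_times f'_meas P_meas)
    then show "(\<lambda>v. indicator {s<..<T} v * (f' v * P v)) \<in> borel_measurable lborel"
      by (simp add: mult.assoc)
    show "AE v in lborel. norm (indicator {s<..<T} v * (f' v * P v)) \<le> norm ((C * P T) * indicator {s<..<T} v)"
    proof (rule AE_I2)
      fix v :: real
      have "\<bar>f' v\<bar> * P v \<le> \<bar>C\<bar> * \<bar>P T\<bar>" if "v \<in> {s<..<T}"
        using C[of v] P_mono[of v] P_pos that s by (intro mult_mono) auto
      then show "norm (indicator {s<..<T} v * (f' v * P v)) \<le> norm ((C * P T) * indicator {s<..<T} v)"
        using P_pos[of v] by (auto simp: indicator_def abs_mult)
    qed
  qed
  have eq: "indicator {s<..<T} t * (f' t * fbm_kernel a t s) =
      s powr a * (indicator {s<..<T} t * ((t - s) powr (-a) * (t powr (-a) * f' t)) +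
        a * (indicator {s<..<T} t * (f' t * P t)))" for t
    by (cases "t \<in> {s<..<T}") (simp_all add: kernel algebra_simps)
  show "integrable lborel (\<lambda>t. indicator {s<..<T} t * (f' t * fbm_kernel a t s))"
    unfolding eq using int2 int3 by (intro integrable_mult_right Bochner_Integration.integrable_add)
  have I3: "(\<integral>t. indicator {s<..<T} t * (f' t * fbm_kernel a t s) \<partial>lborel) =
      s powr a * (abel a T (\<lambda>u. u powr (-a) * f' u) s + a * (\<integral>v. indicator {s<..<T} v * (f' v * P v) \<partial>lborel))"
    unfolding eq abel_def using int2 int3 by simp
  show "fbm_K H T f s = fbm_C1 H / Gamma (H + 1/2) *
      (f T * fbm_kernel a T s - (\<integral>t. indicator {s<..<T} t * (f' t * fbm_kernel a t s) \<partial>lborel))"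
    unfolding fbm_K_eq_abel[OF s] kernel[OF s(2)] I3 I1 I2
    by (intro arg_cong[where f="(*) _"]) (simp add: fbm_g_def algebra_simps)
qed

end

text \<open>For \<open>v > 0\<close> the indicator merely lowers the upper limit to
  \<open>t\<close>. What remains is \<open>fbm_K\<close> with horizon \<open>t\<close> applied to
  the constant 1, whose derivative vanishes, so only the boundary term is left.\<close>

lemma fbm_K_indicator:
  assumes "0 < s" "s < t" "t \<le> T"
  shows "fbm_K H T (indicator {0..t}) s = fbm_C1 H / Gamma (H + 1/2) * fbm_kernel a t s"
proof -
  have "\<forall>\<^sub>F v in nhds s. v \<in> {0<..}"
    using assms by (intro eventually_nhds_in_open) auto
  then have "\<forall>\<^sub>F v in nhds s. (LINT u:{v..T}|lebesgue. (u - v) powr (H - 1/2) * u powr (H - 1/2) * indicator {0..t} u) =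
      (LINT u:{v..t}|lebesgue. (u - v) powr (H - 1/2) * u powr (H - 1/2) * 1)"
    unfolding set_lebesgue_integral_def
    by eventually_elim (use assms in \<open>auto intro!: Bochner_Integration.integral_cong simp: indicator_def\<close>)
  then have "fbm_K H T (indicator {0..t}) s = fbm_K H t (\<lambda>_. 1) s"
    unfolding fbm_K_def by (subst deriv_cong_ev) auto
  also have "\<dots> = fbm_C1 H / Gamma (H + 1/2) *
      (1 * fbm_kernel a t s - (\<integral>x. indicator {s<..<t} x * (0 * fbm_kernel a x s) \<partial>lborel))"
    using assms by (intro fbm_K_eq_kernel(1)) auto
  finally show ?thesis by simp
qed

end

section \<open>Riemann--Stieltjes integrals and Riemann sums\<close>

text \<open>On a cell the increment of \<open>f\<close> is the integral of \<open>f'\<close>, so the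
  error is at most the oscillation of \<open>g\<close> times the bound on \<open>f'\<close> times
  the length; uniform continuity of \<open>g\<close> controls the first factor.\<close>

lemma has_rs_integral_C1:
  fixes f f' g :: "real \<Rightarrow> real"
  assumes T: "0 < T"
    and f: "\<And>t. t \<in> {0..T} \<Longrightarrow> (f has_real_derivative f' t) (at t within {0..T})"
    and f': "continuous_on {0..T} f'" and g: "continuous_on {0..T} g"
  shows "has_rs_integral g f 0 T (integral {0..T} (\<lambda>t. g t * f' t))"
  unfolding has_rs_integral_def
proof (intro allI impI)
  fix \<epsilon> :: real assume "\<epsilon> > 0"
  obtain C where C: "\<And>x. x \<in> {0..T} \<Longrightarrow> norm (f' x) \<le> C"
    using continuous_on_Icc_bounded[OF f'] by blast
  have "C \<ge> 0"
    using C[of 0] T by auto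
  \<comment> \<open>Chosen so that the total error \<open>e * C * T\<close> stays below
    \<open>\<epsilon>\<close>; \<open>C + 1\<close> covers the case \<open>C = 0\<close>.\<close>
  define e where "e = \<epsilon> / (2 * (C + 1) * T)"
  have "e > 0"
    using \<open>\<epsilon> > 0\<close> \<open>C \<ge> 0\<close> T by (simp add: e_def)
  have "uniformly_continuous_on {0..T} g"
    by (intro compact_uniformly_continuous g compact_Icc)
  with \<open>e > 0\<close> obtain \<delta> where \<delta>: "\<delta> > 0"
      "\<And>x t. x \<in> {0..T} \<Longrightarrow> t \<in> {0..T} \<Longrightarrow> dist t x < \<delta> \<Longrightarrow> dist (g t) (g x) < e"
    unfolding uniformly_continuous_on_def by meson
  have "\<bar>(\<Sum>(x, I)\<in>p. g x * (f (Sup I) - f (Inf I))) - integral {0..T} (\<lambda>t. g t * f' t)\<bar> < \<epsilon>"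
    if p: "p tagged_division_of {0..T}" and fine: "\<forall>(x, I)\<in>p. diameter I < \<delta>" for p
  proof -
    have bound: "norm (g x * (f (Sup I) - f (Inf I)) - integral I (\<lambda>t. g t * f' t)) \<le> e * C * measure lborel I"
      if "(x, I) \<in> p" for x I
    proof -
      from tagged_division_ofD(2-4)[OF p that] obtain u v where I: "I = {u..v}" "u \<le> v" "x \<in> I" "I \<subseteq> {0..T}"
        by (auto simp: cbox_interval)
      have f'_has: "(f' has_integral (f v - f u)) I"
        unfolding I(1) using I f by (intro fundamental_theorem_of_calculus)
          (auto simp: has_real_derivative_iff_has_vector_derivative[symmetric] intro: DERIV_subset[of f _ _ "{0..T}"])
      have gf'_int: "(\<lambda>t. g t * f' t) integrable_on I"
        unfolding I(1) using I
        by (intro integrable_continuous_interval continuous_intros continuous_on_subset[OF g] continuous_on_subset[OF f']) auto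
      have "((\<lambda>t. g x * f' t - g t * f' t) has_integral (g x * (f v - f u) - integral I (\<lambda>t. g t * f' t))) (cbox u v)"
        unfolding cbox_interval I(1)[symmetric]
        by (intro has_integral_diff has_integral_mult_right f'_has integrable_integral gf'_int)
      then have "norm (g x * (f v - f u) - integral I (\<lambda>t. g t * f' t)) \<le> e * C * measure lborel (cbox u v)"
      proof (rule has_integral_bound[rotated])
        fix t assume "t \<in> cbox u v"
        then have t: "t \<in> I" by (simp add: I cbox_interval)
        have "dist t x \<le> diameter I"
          using t I(3) by (intro diameter_bounded_bound) (simp_all add: I(1))
        also have "\<dots> < \<delta>" using fine that by auto
        finally have "dist (g t) (g x) < e"
          using t I by (intro \<delta>) auto
        then have "norm (g x - g t) * norm (f' t) \<le> e * C"
          using C[of t] t I \<open>C \<ge> 0\<close> by (intro mult_mono) (auto simp: dist_norm norm_minus_commute)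
        then show "norm (g x * f' t - g t * f' t) \<le> e * C"
          by (simp add: left_diff_distrib[symmetric] abs_mult)
      qed (use \<open>e > 0\<close> \<open>C \<ge> 0\<close> in \<open>auto simp: I(1) cbox_interval\<close>)
      then show ?thesis using I by (simp add: cbox_interval)
    qed
    have "integral {0..T} (\<lambda>t. g t * f' t) = (\<Sum>(x, I)\<in>p. integral I (\<lambda>t. g t * f' t))"
      using integral_combine_tagged_division_topdown[of "\<lambda>t. g t * f' t" 0 T p] p
      by (simp add: cbox_interval integrable_continuous_interval continuous_intros f' g)
    then have "(\<Sum>(x, I)\<in>p. g x * (f (Sup I) - f (Inf I))) - integral {0..T} (\<lambda>t. g t * f' t) =
        (\<Sum>(x, I)\<in>p. g x * (f (Sup I) - f (Inf I)) - integral I (\<lambda>t. g t * f' t))"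
      by (simp add: sum_subtractf[symmetric] case_prod_beta)
    also have "norm \<dots> \<le> (\<Sum>(x, I)\<in>p. e * C * measure lborel I)"
      using bound by (intro sum_norm_le) auto
    also have "\<dots> = e * C * (\<Sum>(x, I)\<in>p. measure lborel I)"
      by (simp add: sum_distrib_left case_prod_beta)
    also have "(\<Sum>(x, I)\<in>p. measure lborel I) = T"
      using additive_content_tagged_division[of p 0 T] p T by (simp add: cbox_interval)
    also have "e * C * T < \<epsilon>"
    proof -
      have "e * C * T = \<epsilon> * (C / (2 * (C + 1)))"
        using \<open>C \<ge> 0\<close> T by (simp add: e_def)
      also have "\<dots> < \<epsilon> * 1"
        using \<open>C \<ge> 0\<close> \<open>\<epsilon> > 0\<close> by (intro mult_strict_left_mono) (auto simp: divide_simps)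
      finally show ?thesis by simp
    qed
    finally show ?thesis by simp
  qed
  with \<delta>(1) show "\<exists>\<delta>>0. \<forall>p. p tagged_division_of {0..T} \<and> (\<forall>(x, I)\<in>p. diameter I < \<delta>) \<longrightarrow>
      \<bar>(\<Sum>(x, I)\<in>p. g x * (f (Sup I) - f (Inf I))) - integral {0..T} (\<lambda>t. g t * f' t)\<bar> < \<epsilon>"
    by blast
qed

lemma has_rs_integral_unique:
  assumes "has_rs_integral g f a b J" "has_rs_integral g f a b K"
  shows "J = K"
proof (rule ccontr)
  assume "J \<noteq> K"
  define \<epsilon> where "\<epsilon> = \<bar>J - K\<bar> / 2"
  have "\<epsilon> > 0" using \<open>J \<noteq> K\<close> by (simp add: \<epsilon>_def)
  from assms(1)[unfolded has_rs_integral_def, rule_format, OF \<open>\<epsilon> > 0\<close>]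
  obtain \<delta>1 where 1: "\<delta>1 > 0" "\<forall>p. p tagged_division_of {a..b} \<and> (\<forall>(x, I)\<in>p. diameter I < \<delta>1) \<longrightarrow>
      \<bar>(\<Sum>(x, I)\<in>p. g x * (f (Sup I) - f (Inf I))) - J\<bar> < \<epsilon>"
    by blast
  from assms(2)[unfolded has_rs_integral_def, rule_format, OF \<open>\<epsilon> > 0\<close>]
  obtain \<delta>2 where 2: "\<delta>2 > 0" "\<forall>p. p tagged_division_of {a..b} \<and> (\<forall>(x, I)\<in>p. diameter I < \<delta>2) \<longrightarrow>
      \<bar>(\<Sum>(x, I)\<in>p. g x * (f (Sup I) - f (Inf I))) - K\<bar> < \<epsilon>"
    by blast
  \<comment> \<open>A division fine for balls of radius \<open>r\<close> exists by Cousin's lemma,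
    and its cells have diameter at most \<open>2 * r\<close>, strictly below both bounds.\<close>
  define r where "r = min \<delta>1 \<delta>2 / 3"
  have "r > 0" using 1(1) 2(1) by (simp add: r_def)
  then have "gauge (\<lambda>x::real. ball x r)" by (rule gauge_ball)
  from fine_division_exists_real[OF this] obtain p where
    p: "p tagged_division_of {a..b}" "(\<lambda>x. ball x r) fine p" by blast
  have "diameter I < \<delta>1 \<and> diameter I < \<delta>2" if "(x, I) \<in> p" for x I
  proof -
    have "I \<subseteq> ball x r" using p(2) that by (auto simp: fine_def)
    then have "diameter I \<le> diameter (ball x r)"
      by (intro diameter_subset) auto
    also have "\<dots> = 2 * r" using \<open>r > 0\<close> by (simp add: diameter_ball)
    finally show ?thesis using \<open>r > 0\<close> by (simp add: r_def min_def split: if_splits)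
  qed
  then have "\<bar>(\<Sum>(x, I)\<in>p. g x * (f (Sup I) - f (Inf I))) - J\<bar> < \<epsilon>"
    "\<bar>(\<Sum>(x, I)\<in>p. g x * (f (Sup I) - f (Inf I))) - K\<bar> < \<epsilon>"
    using 1(2)[rule_format, of p] 2(2)[rule_format, of p] p(1) by auto
  then show False by (simp add: \<epsilon>_def abs_if split: if_splits)
qed

lemma rs_integral_eq: "has_rs_integral g f a b J \<Longrightarrow> rs_integral g f a b = J"
  unfolding rs_integral_def by (intro the_equality) (auto intro: has_rs_integral_unique)

section \<open>Left-endpoint sums on uniform grids\<close>

definition grid_floor :: "real \<Rightarrow> nat \<Rightarrow> real \<Rightarrow> real" where
  "grid_floor T n t = T * real_of_int \<lfloor>t * real n / T\<rfloor> / real n"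

lemma borel_measurable_grid_floor [measurable]: "grid_floor T n \<in> borel_measurable borel"
  unfolding grid_floor_def[abs_def] by measurable

lemma grid_floor_bounds:
  assumes "0 < T" "0 < n" "t \<in> {0..<T}"
  shows "0 \<le> grid_floor T n t" "grid_floor T n t \<le> t" "t < grid_floor T n t + T / real n"
proof -
  define k where "k = real_of_int \<lfloor>t * real n / T\<rfloor>"
  have "k \<le> t * real n / T" "t * real n / T < k + 1"
    unfolding k_def by linarith+
  then have k: "T * k \<le> t * real n" "t * real n < T * k + T"
    using assms(1) by (simp_all add: field_simps)
  have eq: "grid_floor T n t = T * k / real n"
    by (simp add: grid_floor_def k_def)
  show "0 \<le> grid_floor T n t"
    using assms by (auto simp: grid_floor_def)
  show "grid_floor T n t \<le> t" "t < grid_floor T n t + T / real n"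
    using k assms(2) unfolding eq by (simp_all add: field_simps)
qed

lemma grid_floor_eq:
  assumes "0 < T" "0 < n" "t \<in> {T * real i / real n..<T * real (Suc i) / real n}"
  shows "grid_floor T n t = T * real i / real n"
proof -
  have "\<lfloor>t * real n / T\<rfloor> = int i"
    using assms by (intro floor_unique) (auto simp: field_simps)
  then show ?thesis by (simp add: grid_floor_def)
qed

text \<open>Presents the sum as an integral of \<open>f'\<close> against a step function. No
  regularity of \<open>\<phi>\<close> is required, as it is evaluated at finitely many points; this
  serves both the paths of \<open>BH\<close> and the kernel as a function of \<open>t\<close>. The
  interval is half-open because \<open>grid_floor\<close> maps \<open>T\<close> to itself, which is
  no left end point of a cell.\<close>

lemma has_bochner_integral_grid_sum:
  fixes f f' \<phi> :: "real \<Rightarrow> real"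
  assumes T: "0 < T" and n: "0 < n"
    and f: "\<And>t. t \<in> {0..T} \<Longrightarrow> (f has_real_derivative f' t) (at t within {0..T})"
    and f': "continuous_on {0..T} f'"
  shows "has_bochner_integral lborel (\<lambda>t. indicator {0..<T} t * (f' t * \<phi> (grid_floor T n t)))
    (\<Sum>i<n. (f (T * real (Suc i) / real n) - f (T * real i / real n)) * \<phi> (T * real i / real n))"
proof -
  define x where "x i = T * real i / real n" for i
  have x: "0 \<le> x i" "x i \<le> x (Suc i)" for i
    using T by (auto simp: x_def simp del: of_nat_Suc intro!: divide_right_mono mult_left_mono)
  have xT: "x (Suc i) \<le> T" if "i < n" for i
    using that T n mult_left_mono[of "real (Suc i)" "real n" T]
    by (simp add: x_def pos_divide_le_eq del: of_nat_Suc)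
  have piece: "has_bochner_integral lborel (\<lambda>t. indicator {x i..<x (Suc i)} t * f' t) (f (x (Suc i)) - f (x i))"
    if "i < n" for i
  proof -
    have "has_bochner_integral lborel (\<lambda>t. indicator {x i<..<x (Suc i)} t * f' t) (f (x (Suc i)) - f (x i))"
      using x[of i] xT[OF that] f
      by (intro has_bochner_integral_FTC_Ioo continuous_on_subset[OF f'])
        (auto intro: DERIV_subset[of f _ _ "{0..T}"])
    then show ?thesis
      by (rule has_bochner_integral_discrete_difference[THEN iffD1, of "{x i}", rotated -1])
        (auto simp: indicator_def)
  qed
  have "has_bochner_integral lborel (\<lambda>t. \<Sum>i<n. (indicator {x i..<x (Suc i)} t * f' t) * \<phi> (x i))
      (\<Sum>i<n. (f (x (Suc i)) - f (x i)) * \<phi> (x i))"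
    by (intro has_bochner_integral_sum has_bochner_integral_mult_left piece) auto
  moreover have "(\<Sum>i<n. (indicator {x i..<x (Suc i)} t * f' t) * \<phi> (x i)) =
      indicator {0..<T} t * (f' t * \<phi> (grid_floor T n t))" for t
  proof (cases "t \<in> {0..<T}")
    case True
    define j where "j = nat \<lfloor>t * real n / T\<rfloor>"
    have "t * real n / T \<ge> 0" using True T by auto
    then have j: "real j = real_of_int \<lfloor>t * real n / T\<rfloor>"
      by (simp add: j_def)
    have "real j \<le> t * real n / T" "t * real n / T < real j + 1"
      unfolding j by linarith+
    then have tj: "t \<in> {x j..<x (Suc j)}"
      using T n by (auto simp: x_def field_simps)
    have "t * real n / T < real n"
      using True T n by (simp add: pos_divide_less_eq)
    then have "real j < real n"
      using \<open>real j \<le> t * real n / T\<close> by linarith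
    then have "j < n" by simp
    have eq: "i = j" if "t \<in> {x i..<x (Suc i)}" for i
    proof -
      have "T * real i / real n = T * real j / real n"
        using grid_floor_eq[OF T n] that tj by (metis x_def)
      then show ?thesis using T n by simp
    qed
    have "(\<Sum>i<n. (indicator {x i..<x (Suc i)} t * f' t) * \<phi> (x i)) =
        (\<Sum>i\<in>{j}. (indicator {x i..<x (Suc i)} t * f' t) * \<phi> (x i))"
      using \<open>j < n\<close> eq by (intro sum.mono_neutral_right) (auto simp: indicator_def)
    also have "\<dots> = f' t * \<phi> (grid_floor T n t)"
      using tj grid_floor_eq[OF T n, of t j] by (simp add: x_def)
    finally show ?thesis using True by simp
  next
    case False
    have "indicator {x i..<x (Suc i)} t = (0::real)" if "i < n" for i
      using False x[of i] xT[OF that] by (auto simp: indicator_def)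
    with False show ?thesis by simp
  qed
  ultimately show ?thesis by (simp add: x_def)
qed

lemma integral_indicator_Ico:
  fixes F :: "real \<Rightarrow> real"
  assumes "continuous_on {0..T} F"
  shows "integrable lborel (\<lambda>t. indicator {0..<T} t * F t)"
    and "(\<integral>t. indicator {0..<T} t * F t \<partial>lborel) = integral {0..T} F"
proof -
  have int: "set_integrable lborel {0..T} F"
    by (rule borel_integrable_compact[OF compact_Icc assms, folded set_integrable_def])
  then have "has_bochner_integral lborel (\<lambda>t. indicator {0..T} t *\<^sub>R F t) (integral {0..T} F)"
    using set_borel_integral_eq_integral(2)[OF int]
    by (simp add: has_bochner_integral_iff set_integrable_def set_lebesgue_integral_def)
  then have "has_bochner_integral lborel (\<lambda>t. indicator {0..<T} t * F t) (integral {0..T} F)"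
    by (rule has_bochner_integral_discrete_difference[THEN iffD1, of "{T}", rotated -1])
      (auto simp: indicator_def)
  then show "integrable lborel (\<lambda>t. indicator {0..<T} t * F t)"
    "(\<integral>t. indicator {0..<T} t * F t \<partial>lborel) = integral {0..T} F"
    by (auto simp: has_bochner_integral_iff)
qed

lemma LIMSEQ_mesh: "(\<lambda>n. T / real (Suc n)) \<longlonglongrightarrow> 0"
  using tendsto_mult[OF tendsto_const[of T] LIMSEQ_inverse_real_of_nat] by (simp add: divide_inverse)

lemma grid_floor_tendsto:
  assumes "0 < T" "t \<in> {0..<T}"
  shows "(\<lambda>n. grid_floor T (Suc n) t) \<longlonglongrightarrow> t"
proof (rule tendsto_sandwich)
  show "\<forall>\<^sub>F n in sequentially. t - T / real (Suc n) \<le> grid_floor T (Suc n) t"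
    using grid_floor_bounds(3)[OF assms(1) zero_less_Suc assms(2)]
    by (intro always_eventually allI) (simp add: diff_le_eq less_imp_le del: of_nat_Suc)
  show "\<forall>\<^sub>F n in sequentially. grid_floor T (Suc n) t \<le> t"
    using grid_floor_bounds(2)[OF assms(1) _ assms(2)] by (intro always_eventually allI) simp
  show "(\<lambda>n. t - T / real (Suc n)) \<longlonglongrightarrow> t"
    using tendsto_diff[OF tendsto_const LIMSEQ_mesh] by simp
qed simp

lemma grid_sum_tendsto:
  fixes f f' g :: "real \<Rightarrow> real"
  assumes T: "0 < T"
    and f: "\<And>t. t \<in> {0..T} \<Longrightarrow> (f has_real_derivative f' t) (at t within {0..T})"
    and f': "continuous_on {0..T} f'" and g: "continuous_on {0..T} g"
  shows "(\<lambda>n. \<Sum>i<Suc n. (f (T * real (Suc i) / real (Suc n)) - f (T * real i / real (Suc n))) * g (T * real i / real (Suc n)))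
    \<longlonglongrightarrow> integral {0..T} (\<lambda>t. g t * f' t)"
proof -
  note grid = has_bochner_integral_grid_sum[OF T zero_less_Suc f f', where \<phi>=g]
  obtain C where C: "\<And>x. x \<in> {0..T} \<Longrightarrow> norm (f' x) \<le> C"
    using continuous_on_Icc_bounded[OF f'] by blast
  obtain D where D: "\<And>x. x \<in> {0..T} \<Longrightarrow> norm (g x) \<le> D"
    using continuous_on_Icc_bounded[OF g] by blast
  have "0 \<le> C" "0 \<le> D" using C[of 0] D[of 0] T by auto
  have cont: "continuous_on {0..T} (\<lambda>t. g t * f' t)"
    by (intro continuous_intros f' g)
  have "(\<lambda>n. \<integral>t. indicator {0..<T} t * (f' t * g (grid_floor T (Suc n) t)) \<partial>lborel)
      \<longlonglongrightarrow> (\<integral>t. indicator {0..<T} t * (g t * f' t) \<partial>lborel)"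
  proof (rule integral_dominated_convergence)
    show "integrable lborel (\<lambda>t. indicator {0..<T} t * (C * D))"
      by (intro integral_indicator_Ico) auto
    show "(\<lambda>t. indicator {0..<T} t * (g t * f' t)) \<in> borel_measurable lborel"
      using integral_indicator_Ico(1)[OF cont] by (rule borel_measurable_integrable)
    show "(\<lambda>t. indicator {0..<T} t * (f' t * g (grid_floor T (Suc n) t))) \<in> borel_measurable lborel" for n
      by (rule borel_measurable_has_bochner_integral[OF grid])
    show "AE t in lborel. norm (indicator {0..<T} t * (f' t * g (grid_floor T (Suc n) t))) \<le> indicator {0..<T} t * (C * D)" for n
    proof (rule AE_I2)
      fix t :: real
      show "norm (indicator {0..<T} t * (f' t * g (grid_floor T (Suc n) t))) \<le> indicator {0..<T} t * (C * D)"
      proof (cases "t \<in> {0..<T}")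
        case True
        then have "grid_floor T (Suc n) t \<in> {0..T}"
          using grid_floor_bounds[OF T zero_less_Suc True, of n] by auto
        with True show ?thesis
          using C[of t] D[of "grid_floor T (Suc n) t"] \<open>0 \<le> C\<close>
          by (auto simp: abs_mult intro!: mult_mono)
      qed simp
    qed
    show "AE t in lborel. (\<lambda>n. indicator {0..<T} t * (f' t * g (grid_floor T (Suc n) t)))
        \<longlonglongrightarrow> indicator {0..<T} t * (g t * f' t)"
    proof (rule AE_I2)
      fix t :: real
      show "(\<lambda>n. indicator {0..<T} t * (f' t * g (grid_floor T (Suc n) t)))
        \<longlonglongrightarrow> indicator {0..<T} t * (g t * f' t)"
      proof (cases "t \<in> {0..<T}")
        case True
        have "grid_floor T (Suc n) t \<in> {0..T}" for n
          using grid_floor_bounds[OF T zero_less_Suc True, of n] True by auto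
        then have "(\<lambda>n. g (grid_floor T (Suc n) t)) \<longlonglongrightarrow> g t"
          using True by (intro continuous_on_tendsto_compose[OF g] grid_floor_tendsto T always_eventually) auto
        then show ?thesis
          by (subst mult.commute[of "g t"]) (intro tendsto_intros)
      qed simp
    qed
  qed
  moreover have "(\<integral>t. indicator {0..<T} t * (f' t * g (grid_floor T (Suc n) t)) \<partial>lborel) =
      (\<Sum>i<Suc n. (f (T * real (Suc i) / real (Suc n)) - f (T * real i / real (Suc n))) * g (T * real i / real (Suc n)))" for n
    by (rule has_bochner_integral_integral_eq[OF grid])
  ultimately show ?thesis
    by (simp only: integral_indicator_Ico(2)[OF cont])
qed

section \<open>Convergence in mean square\<close>

text \<open>Finite exceptional sets suffice, since the formulas for \<open>fbm_K\<close> fail at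
  most at \<open>0\<close>, \<open>t\<close> or \<open>T\<close>.\<close>

lemma has_wiener_integral_cong:
  assumes wi: "has_wiener_integral M B T h Y" and X: "finite X"
    and eq: "\<And>s. s \<in> {0..T} - X \<Longrightarrow> h s = h' s"
  shows "has_wiener_integral M B T h' Y"
proof -
  define N where "N = lebesgue_on {0..T}"
  define X' where "X' = X \<inter> {0..T}"
  have X': "countable X'"
    using X by (simp add: X'_def countable_finite)
  have null: "emeasure N {x} = 0" and sets: "{x} \<in> sets N" if "x \<in> X'" for x
    using that by (auto simp: N_def X'_def emeasure_restrict_space sets_restrict_space_iff)
  have eq': "h s = h' s" if "s \<in> space N" "s \<notin> X'" for s
    using that eq by (auto simp: N_def X'_def)
  have h: "h \<in> borel_measurable N" "integrable N (\<lambda>s. (h s)\<^sup>2)"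
    using has_wiener_integral_L2(1)[OF wi] by (auto simp: L2_fun_def N_def)
  have "h' \<in> borel_measurable N"
    by (rule measurable_discrete_difference[OF h(1) X' sets _ eq']) auto
  moreover have "integrable N (\<lambda>s. (h' s)\<^sup>2)"
    using h(2) by (rule integrable_discrete_difference[OF X' null sets, THEN iffD1, rotated -1]) (simp_all add: eq')
  ultimately have L2: "L2_fun (lebesgue_on {0..T}) h'"
    by (simp add: L2_fun_def N_def)
  have "(\<integral>s. (h s - F s)\<^sup>2 \<partial>N) = (\<integral>s. (h' s - F s)\<^sup>2 \<partial>N)" for F
    by (rule integral_discrete_difference[OF X' null sets]) (simp_all add: eq')
  with wi L2 show ?thesis
    unfolding has_wiener_integral_iff N_def by simp
qed

text \<open>Fatou's lemma in \<open>m\<close>, applied to the squares of \<open>Y m - Y n\<close>: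
  the Cauchy bound passes to the almost sure limit as an error bound.\<close>

lemma L2_fun_limit:
  assumes L2: "\<And>n. L2_fun M (Y n)" and meas: "Z \<in> borel_measurable M"
    and lim: "AE \<omega> in M. (\<lambda>n. Y n \<omega>) \<longlonglongrightarrow> Z \<omega>"
    and bound: "\<And>m n. n \<le> m \<Longrightarrow> (\<integral>\<omega>. (Y m \<omega> - Y n \<omega>)\<^sup>2 \<partial>M) \<le> b n"
  shows "L2_fun M Z" and "(\<integral>\<omega>. (Z \<omega> - Y n \<omega>)\<^sup>2 \<partial>M) \<le> b n"
proof -
  have [measurable]: "Y n \<in> borel_measurable M" for n
    using L2 by (simp add: L2_fun_def)
  note meas [measurable]
  have L2_diff: "L2_fun M (\<lambda>\<omega>. Z \<omega> - Y n \<omega>) \<and> (\<integral>\<omega>. (Z \<omega> - Y n \<omega>)\<^sup>2 \<partial>M) \<le> b n" for n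
  proof -
    have "b n \<ge> 0"
      using bound[of n n] by simp
    have "AE \<omega> in M. ennreal ((Z \<omega> - Y n \<omega>)\<^sup>2) = liminf (\<lambda>m. ennreal ((Y m \<omega> - Y n \<omega>)\<^sup>2))"
      using lim
    proof eventually_elim
      case (elim \<omega>)
      have "(\<lambda>m. ennreal ((Y m \<omega> - Y n \<omega>)\<^sup>2)) \<longlonglongrightarrow> ennreal ((Z \<omega> - Y n \<omega>)\<^sup>2)"
        by (intro tendsto_ennrealI tendsto_intros elim)
      then show ?case
        by (intro lim_imp_Liminf[symmetric]) simp_all
    qed
    then have "(\<integral>\<^sup>+\<omega>. ennreal ((Z \<omega> - Y n \<omega>)\<^sup>2) \<partial>M) = (\<integral>\<^sup>+\<omega>. liminf (\<lambda>m. ennreal ((Y m \<omega> - Y n \<omega>)\<^sup>2)) \<partial>M)"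
      by (rule nn_integral_cong_AE)
    also have "\<dots> \<le> liminf (\<lambda>m. \<integral>\<^sup>+\<omega>. ennreal ((Y m \<omega> - Y n \<omega>)\<^sup>2) \<partial>M)"
      by (rule nn_integral_liminf) measurable
    also have "\<dots> \<le> ennreal (b n)"
    proof (rule Liminf_le)
      have "(\<integral>\<^sup>+\<omega>. ennreal ((Y m \<omega> - Y n \<omega>)\<^sup>2) \<partial>M) \<le> ennreal (b n)" if "n \<le> m" for m
        using bound[OF that] L2_fun_integrable_sq[OF L2_fun_diff[OF L2 L2]]
        by (subst nn_integral_eq_integral) (auto intro: ennreal_leI)
      then show "\<forall>\<^sub>F m in sequentially. (\<integral>\<^sup>+\<omega>. ennreal ((Y m \<omega> - Y n \<omega>)\<^sup>2) \<partial>M) \<le> ennreal (b n)"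
        by (auto simp: eventually_sequentially)
    qed simp
    finally have *: "(\<integral>\<^sup>+\<omega>. ennreal ((Z \<omega> - Y n \<omega>)\<^sup>2) \<partial>M) \<le> ennreal (b n)" .
    have int: "integrable M (\<lambda>\<omega>. (Z \<omega> - Y n \<omega>)\<^sup>2)"
      using * by (intro integrableI_bounded) (auto simp: less_top[symmetric] top_unique intro: le_less_trans)
    with * \<open>b n \<ge> 0\<close> show ?thesis
      by (subst (asm) nn_integral_eq_integral) (auto simp: L2_fun_def)
  qed
  from L2_fun_add[OF conjunct1[OF L2_diff[of 0]] L2[of 0]] show "L2_fun M Z"
    by simp
  show "(\<integral>\<omega>. (Z \<omega> - Y n \<omega>)\<^sup>2 \<partial>M) \<le> b n"
    using L2_diff by blast
qed

text \<open>Connects the completed measure of the definitions with \<open>lborel\<close>, on which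
  Fubini's theorem is applied.\<close>

lemma
  fixes F :: "real \<Rightarrow> real"
  assumes "F \<in> borel_measurable borel" "\<And>s. s \<notin> {0..T} \<Longrightarrow> F s = 0"
  shows integrable_lebesgue_on_iff_lborel: "integrable (lebesgue_on {0..T}) F \<longleftrightarrow> integrable lborel F"
    and integral_lebesgue_on_eq_lborel: "integral\<^sup>L (lebesgue_on {0..T}) F = integral\<^sup>L lborel F"
proof -
  have "(\<lambda>s. indicator {0..T} s *\<^sub>R F s) = F"
  proof
    show "indicator {0..T} s *\<^sub>R F s = F s" for s
      using assms(2)[of s] by (cases "s \<in> {0..T}") auto
  qed
  then show "integrable (lebesgue_on {0..T}) F \<longleftrightarrow> integrable lborel F"
    "integral\<^sup>L (lebesgue_on {0..T}) F = integral\<^sup>L lborel F"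
    using assms(1) by (simp_all add: integrable_restrict_space integral_restrict_space integrable_completion
        integral_completion del: real_scaleR_def)
qed

text \<open>The kernel \<open>k\<^sub>t\<close> of the overview, normalized and extended by zero to
  the whole line.\<close>

definition volterra_kernel :: "real \<Rightarrow> real \<Rightarrow> real \<Rightarrow> real" where
  "volterra_kernel H t s = fbm_C1 H / Gamma (H + 1/2) * fbm_kernel (1/2 - H) t s"

lemma borel_measurable_volterra_kernel [measurable (raw)]:
  assumes "f \<in> borel_measurable N" "g \<in> borel_measurable N"
  shows "(\<lambda>x. volterra_kernel H (f x) (g x)) \<in> borel_measurable N"
proof -
  have "(\<lambda>x. (f x, g x)) \<in> measurable N (borel \<Otimes>\<^sub>M borel)"
    using assms by simp
  from measurable_compose[OF this borel_measurable_fbm_kernel[of "1/2 - H"]] show ?thesis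
    unfolding volterra_kernel_def by simp
qed

lemma volterra_kernel_eq_0: "\<not> (0 < s \<and> s < t) \<Longrightarrow> volterra_kernel H t s = 0"
  by (auto simp: volterra_kernel_def fbm_kernel_def)

section \<open>Transfer between fractional Brownian motion and its kernel\<close>

context
  fixes M :: "'a measure" and H T :: real and BH B :: "real \<Rightarrow> 'a \<Rightarrow> real"
  assumes H: "0 < H" "H < 1/2" and T: "0 < T"
    and fbm: "fractional_brownian_motion M H {0..T} BH"
    and underlying: "underlying_wiener_process M H T BH B"
begin

lemma wiener_B: "wiener_process M {0..T} B"
  using underlying by (simp add: underlying_wiener_process_def)

lemma BH_L2: "t \<in> {0..T} \<Longrightarrow> L2_fun M (BH t)"
  using fbm by (auto simp: fractional_brownian_motion_def intro: centered_gaussian_process_L2)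

lemma has_wiener_integral_volterra_kernel:
  assumes t: "t \<in> {0..T}"
  shows "has_wiener_integral M B T (volterra_kernel H t) (BH t)"
proof (rule has_wiener_integral_cong)
  show "has_wiener_integral M B T (\<lambda>s. fbm_K H T (indicator {0..t}) s * indicator {..t} s) (BH t)"
    using underlying t by (intro has_wiener_integral_extend) (auto simp: underlying_wiener_process_def)
  show "fbm_K H T (indicator {0..t}) s * indicator {..t} s = volterra_kernel H t s" if "s \<in> {0..T} - {0, t}" for s
  proof (cases "s < t")
    case True
    with that t show ?thesis
      using fbm_K_indicator[OF H refl, of s t T] by (simp add: volterra_kernel_def)
  next
    case False
    with that show ?thesis by (auto simp: volterra_kernel_eq_0)
  qed
qed simp

lemma BH_increment:
  assumes "s \<in> {0..T}" "t \<in> {0..T}"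
  shows "(\<integral>\<omega>. (BH t \<omega> - BH s \<omega>)\<^sup>2 \<partial>M) = \<bar>t - s\<bar> powr (2 * H)"
proof -
  have cov: "(\<integral>\<omega>. BH x \<omega> * BH y \<omega> \<partial>M) = (y powr (2 * H) + x powr (2 * H) - \<bar>y - x\<bar> powr (2 * H)) / 2"
    if "x \<in> {0..T}" "y \<in> {0..T}" for x y
    using fbm that by (simp add: fractional_brownian_motion_def centered_gaussian_process_def)
  have int: "integrable M (\<lambda>\<omega>. BH x \<omega> * BH y \<omega>)" if "x \<in> {0..T}" "y \<in> {0..T}" for x y
    using that by (intro L2_fun_mult_integrable BH_L2)
  have "(\<integral>\<omega>. (BH t \<omega> - BH s \<omega>)\<^sup>2 \<partial>M) =
      (\<integral>\<omega>. BH t \<omega> * BH t \<omega> + BH s \<omega> * BH s \<omega> - 2 * (BH s \<omega> * BH t \<omega>) \<partial>M)"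
    by (intro Bochner_Integration.integral_cong refl) (simp add: power2_eq_square algebra_simps)
  also have "\<dots> = \<bar>t - s\<bar> powr (2 * H)"
    using assms by (simp add: int) (simp add: cov field_simps)
  finally show ?thesis .
qed

text \<open>The isometry read backwards: the difference of kernels has the Wiener integral
  \<open>BH t - BH s\<close>, whose second moment is known from the covariance. The factor 4 is that
  of the crude isometry.\<close>

lemma volterra_kernel_increment:
  assumes st: "s \<in> {0..T}" "t \<in> {0..T}"
  shows "(\<integral>\<^sup>+x. ennreal ((volterra_kernel H t x - volterra_kernel H s x)\<^sup>2) \<partial>lborel)
    \<le> ennreal (4 * \<bar>t - s\<bar> powr (2 * H))"
proof -
  define D where "D x = volterra_kernel H t x - volterra_kernel H s x" for x
  have [measurable]: "D \<in> borel_measurable borel"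
    unfolding D_def by measurable
  have D0: "(D x)\<^sup>2 = 0" if "x \<notin> {0..T}" for x
    using that st by (auto simp: D_def volterra_kernel_eq_0)
  have "has_wiener_integral M B T (\<lambda>x. 1 * volterra_kernel H t x + (-1) * volterra_kernel H s x)
      (\<lambda>\<omega>. 1 * BH t \<omega> + (-1) * BH s \<omega>)"
    using st by (intro has_wiener_integral_linear wiener_B has_wiener_integral_volterra_kernel)
  then have wi: "has_wiener_integral M B T D (\<lambda>\<omega>. BH t \<omega> - BH s \<omega>)"
    by (simp add: D_def[abs_def])
  have "integrable lborel (\<lambda>x. (D x)\<^sup>2)"
    using L2_fun_integrable_sq[OF has_wiener_integral_L2(1)[OF wi]]
    by (subst (asm) integrable_lebesgue_on_iff_lborel) (auto simp: D0)
  then have "(\<integral>\<^sup>+x. ennreal ((D x)\<^sup>2) \<partial>lborel) = ennreal (\<integral>x. (D x)\<^sup>2 \<partial>lborel)"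
    by (intro nn_integral_eq_integral) auto
  also have "(\<integral>x. (D x)\<^sup>2 \<partial>lborel) = (\<integral>x. (D x)\<^sup>2 \<partial>lebesgue_on {0..T})"
    by (rule integral_lebesgue_on_eq_lborel[symmetric]) (auto simp: D0)
  also have "ennreal \<dots> \<le> ennreal (4 * \<bar>t - s\<bar> powr (2 * H))"
    using has_wiener_integral_bounds(2)[OF wiener_B wi] BH_increment[OF st] by (intro ennreal_leI) simp
  finally show ?thesis by (simp add: D_def)
qed

section \<open>Approximation of \<open>fbm_K H T f\<close> and of its integral by grid sums\<close>

context
  fixes f f' :: "real \<Rightarrow> real"
  assumes f: "\<And>t. t \<in> {0..T} \<Longrightarrow> (f has_real_derivative f' t) (at t within {0..T})"
    and f': "continuous_on {0..T} f'"
begin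

definition grid :: "nat \<Rightarrow> nat \<Rightarrow> real" where
  "grid n i = T * real i / real (Suc n)"

text \<open>Linear in \<open>\<phi>\<close>, like the integral itself: inserting the kernel gives an
  integrand, and inserting a path of \<open>BH\<close> gives the Wiener integral of that
  integrand.\<close>

definition fbm_grid_sum :: "nat \<Rightarrow> (real \<Rightarrow> real) \<Rightarrow> real" where
  "fbm_grid_sum n \<phi> = f T * \<phi> T - (\<Sum>i<Suc n. (f (grid n (Suc i)) - f (grid n i)) * \<phi> (grid n i))"

text \<open>A Borel function on the whole line that agrees with \<open>fbm_K H T f\<close> on the
  open interval and vanishes outside it.\<close>

definition fbm_K_volterra :: "real \<Rightarrow> real" where
  "fbm_K_volterra s = f T * volterra_kernel H T s - (\<integral>t. indicator {0..<T} t * (f' t * volterra_kernel H t s) \<partial>lborel)"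

lemma grid_mem: "i < Suc n \<Longrightarrow> grid n i \<in> {0..T}"
  using T mult_left_mono[of "real i" "real (Suc n)" T]
  by (auto simp: grid_def pos_divide_le_eq simp del: of_nat_Suc)

lemma has_wiener_integral_fbm_grid_sum:
  "has_wiener_integral M B T (\<lambda>s. fbm_grid_sum n (\<lambda>t. volterra_kernel H t s)) (\<lambda>\<omega>. fbm_grid_sum n (\<lambda>t. BH t \<omega>))"
proof -
  have "has_wiener_integral M B T
     (\<lambda>s. f T * volterra_kernel H T s + (-1) * (\<Sum>i<Suc n. (f (grid n (Suc i)) - f (grid n i)) * volterra_kernel H (grid n i) s))
     (\<lambda>\<omega>. f T * BH T \<omega> + (-1) * (\<Sum>i<Suc n. (f (grid n (Suc i)) - f (grid n i)) * BH (grid n i) \<omega>))"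
    using T grid_mem
    by (intro has_wiener_integral_linear has_wiener_integral_sum wiener_B has_wiener_integral_volterra_kernel) auto
  then show ?thesis by (simp add: fbm_grid_sum_def del: sum.lessThan_Suc)
qed

lemma integrable_volterra_kernel:
  "integrable lborel (\<lambda>t. indicator {0..<T} t * (f' t * volterra_kernel H t s))"
proof (cases "0 < s \<and> s < T")
  case True
  have "indicator {0..<T} t * (f' t * volterra_kernel H t s) = fbm_C1 H / Gamma (H + 1/2) *
      (indicator {s<..<T} t * (f' t * fbm_kernel (1/2 - H) t s))" for t
    using True by (auto simp: indicator_def volterra_kernel_def fbm_kernel_def)
  then show ?thesis
    using fbm_K_eq_kernel(2)[OF H refl T f f', of s] True by simp
next
  case False
  then have "(\<lambda>t. indicator {0..<T} t * (f' t * volterra_kernel H t s)) = (\<lambda>_. 0)"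
    by (auto simp: indicator_def volterra_kernel_eq_0)
  then show ?thesis by (simp only: integrable_zero)
qed

lemma fbm_K_eq_volterra:
  assumes "0 < s" "s < T"
  shows "fbm_K H T f s = fbm_K_volterra s"
proof -
  define c where "c = fbm_C1 H / Gamma (H + 1/2)"
  have "(\<lambda>t. indicator {0..<T} t * (f' t * volterra_kernel H t s)) =
      (\<lambda>t. c * (indicator {s<..<T} t * (f' t * fbm_kernel (1/2 - H) t s)))"
    using assms by (auto simp: indicator_def volterra_kernel_def fbm_kernel_def c_def)
  then have "fbm_K_volterra s = c * (f T * fbm_kernel (1/2 - H) T s -
      (\<integral>t. indicator {s<..<T} t * (f' t * fbm_kernel (1/2 - H) t s) \<partial>lborel))"
    unfolding fbm_K_volterra_def by (simp only: integral_mult_right_zero) (simp add: volterra_kernel_def c_def right_diff_distrib)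
  also have "\<dots> = fbm_K H T f s"
    unfolding c_def by (rule fbm_K_eq_kernel(1)[OF H refl T f f' assms, symmetric])
  finally show ?thesis ..
qed

lemma fbm_K_volterra_eq_0: "\<not> (0 < s \<and> s < T) \<Longrightarrow> fbm_K_volterra s = 0"
proof -
  assume s: "\<not> (0 < s \<and> s < T)"
  then have "(\<lambda>t. indicator {0..<T} t * (f' t * volterra_kernel H t s)) = (\<lambda>_. 0)"
    by (auto simp: indicator_def volterra_kernel_eq_0)
  then show ?thesis
    unfolding fbm_K_volterra_def using s by (simp only: integral_zero) (simp add: volterra_kernel_eq_0)
qed

lemma f'_measurable: "(\<lambda>t. indicator {0..<T} t * f' t) \<in> borel_measurable borel"
  using integral_indicator_Ico(1)[OF f'] by (auto dest: borel_measurable_integrable)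

lemma fbm_K_volterra_measurable: "fbm_K_volterra \<in> borel_measurable borel"
proof -
  note f'_measurable [measurable]
  have "(\<lambda>s. \<integral>t. (indicator {0..<T} t * f' t) * volterra_kernel H t s \<partial>lborel) \<in> borel_measurable borel"
    by measurable
  then have [measurable]: "(\<lambda>s. \<integral>t. indicator {0..<T} t * (f' t * volterra_kernel H t s) \<partial>lborel) \<in> borel_measurable borel"
    by (simp add: mult.assoc)
  show ?thesis
    unfolding fbm_K_volterra_def[abs_def] by measurable
qed

text \<open>For fixed \<open>s\<close> the error is the integral over \<open>t\<close> of
  \<open>f' t\<close> times the increment of the kernel from \<open>t\<close> to its grid point.
  Cauchy-Schwarz in \<open>t\<close> and Tonelli reduce its square integral to kernel increments
  over at most one mesh width.\<close>

lemma fbm_K_volterra_approximation: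
  obtains A where "\<And>n. (\<integral>\<^sup>+s. ennreal ((fbm_K_volterra s - fbm_grid_sum n (\<lambda>t. volterra_kernel H t s))\<^sup>2) \<partial>lborel)
    \<le> ennreal (A * (T / real (Suc n)) powr (2 * H))" "A \<ge> 0"
proof -
  obtain C where C: "\<And>x. x \<in> {0..T} \<Longrightarrow> norm (f' x) \<le> C"
    using continuous_on_Icc_bounded[OF f'] by blast
  have "C \<ge> 0" using C[of 0] T by auto
  \<comment> \<open>\<open>C\<^sup>2 * T\<close> comes from Cauchy-Schwarz, 4 from the isometry
    bound and the last \<open>T\<close> from integrating over \<open>t\<close>.\<close>
  define A where "A = C\<^sup>2 * T * (4 * T)"
  have "(\<integral>\<^sup>+s. ennreal ((fbm_K_volterra s - fbm_grid_sum n (\<lambda>t. volterra_kernel H t s))\<^sup>2) \<partial>lborel)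
    \<le> ennreal (A * (T / real (Suc n)) powr (2 * H))" for n
  proof -
    define d where "d t s = volterra_kernel H (grid_floor T (Suc n) t) s - volterra_kernel H t s" for t s
    have [measurable]: "(\<lambda>x. d (g x) (h x)) \<in> borel_measurable N"
      if [measurable]: "g \<in> borel_measurable N" "h \<in> borel_measurable N" for g h and N :: "'b measure"
      unfolding d_def by measurable
    have pointwise: "ennreal ((fbm_K_volterra s - fbm_grid_sum n (\<lambda>t. volterra_kernel H t s))\<^sup>2) \<le>
        ennreal (C\<^sup>2 * T) * (\<integral>\<^sup>+t. ennreal (indicator {0..<T} t * (d t s)\<^sup>2) \<partial>lborel)" for s
    proof -
      note grid = has_bochner_integral_grid_sum[OF T zero_less_Suc f f', where \<phi>="\<lambda>t. volterra_kernel H t s", of n]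
      have "integrable lborel (\<lambda>t. indicator {0..<T} t * (f' t * volterra_kernel H (grid_floor T (Suc n) t) s) -
          indicator {0..<T} t * (f' t * volterra_kernel H t s))"
        using grid integrable_volterra_kernel by (intro Bochner_Integration.integrable_diff) (auto simp: has_bochner_integral_iff)
      then have int: "integrable lborel (\<lambda>t. indicator {0..<T} t * (f' t * d t s))"
        by (simp add: d_def algebra_simps)
      have "(\<Sum>i<Suc n. (f (grid n (Suc i)) - f (grid n i)) * volterra_kernel H (grid n i) s) =
          (\<integral>t. indicator {0..<T} t * (f' t * volterra_kernel H (grid_floor T (Suc n) t) s) \<partial>lborel)"
        unfolding grid_def by (rule has_bochner_integral_integral_eq[OF grid, symmetric])
      then have "fbm_K_volterra s - fbm_grid_sum n (\<lambda>t. volterra_kernel H t s) =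
          (\<integral>t. indicator {0..<T} t * (f' t * volterra_kernel H (grid_floor T (Suc n) t) s) \<partial>lborel) -
          (\<integral>t. indicator {0..<T} t * (f' t * volterra_kernel H t s) \<partial>lborel)"
        unfolding fbm_K_volterra_def fbm_grid_sum_def by simp
      also have "\<dots> = (\<integral>t. indicator {0..<T} t * (f' t * volterra_kernel H (grid_floor T (Suc n) t) s) -
          indicator {0..<T} t * (f' t * volterra_kernel H t s) \<partial>lborel)"
        using grid integrable_volterra_kernel
        by (intro Bochner_Integration.integral_diff[symmetric]) (auto simp: has_bochner_integral_iff)
      also have "\<dots> = (\<integral>t. indicator {0..<T} t * (f' t * d t s) \<partial>lborel)"
        by (simp add: d_def algebra_simps)
      finally have eq: "fbm_K_volterra s - fbm_grid_sum n (\<lambda>t. volterra_kernel H t s) =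
          (\<integral>t. indicator {0..<T} t * (f' t * d t s) \<partial>lborel)" .
      \<comment> \<open>The estimate continues with nonnegative integrals: they allow the square of
        the increment to have an infinite integral over \<open>t\<close> for some \<open>s\<close>,
        and Tonelli then applies without integrability.\<close>
      have "ennreal ((fbm_K_volterra s - fbm_grid_sum n (\<lambda>t. volterra_kernel H t s))\<^sup>2) =
          (ennreal (norm (\<integral>t. indicator {0..<T} t * (f' t * d t s) \<partial>lborel)))\<^sup>2"
        unfolding eq by (simp add: ennreal_power)
      also have "\<dots> \<le> (\<integral>\<^sup>+t. norm (indicator {0..<T} t * (f' t * d t s)) \<partial>lborel)\<^sup>2"
        by (intro power_mono integral_norm_bound_ennreal int) auto
      also have "\<dots> \<le> (\<integral>\<^sup>+t. ennreal (C * indicator {0..<T} t) * ennreal (indicator {0..<T} t * \<bar>d t s\<bar>) \<partial>lborel)\<^sup>2"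
      proof (intro power_mono nn_integral_mono)
        fix t :: real
        have "norm (indicator {0..<T} t * (f' t * d t s)) \<le> (C * indicator {0..<T} t) * (indicator {0..<T} t * \<bar>d t s\<bar>)"
          using C[of t] by (auto simp: indicator_def abs_mult intro!: mult_right_mono)
        then have "ennreal (norm (indicator {0..<T} t * (f' t * d t s))) \<le>
            ennreal ((C * indicator {0..<T} t) * (indicator {0..<T} t * \<bar>d t s\<bar>))"
          by (rule ennreal_leI)
        then show "ennreal (norm (indicator {0..<T} t * (f' t * d t s))) \<le>
            ennreal (C * indicator {0..<T} t) * ennreal (indicator {0..<T} t * \<bar>d t s\<bar>)"
          using \<open>C \<ge> 0\<close> by (subst ennreal_mult[symmetric]) auto
      qed auto
      also have "\<dots> \<le> (\<integral>\<^sup>+t. (ennreal (C * indicator {0..<T} t))\<^sup>2 \<partial>lborel) *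
          (\<integral>\<^sup>+t. (ennreal (indicator {0..<T} t * \<bar>d t s\<bar>))\<^sup>2 \<partial>lborel)"
        by (rule Cauchy_Schwarz_nn_integral) measurable
      also have "(\<integral>\<^sup>+t. (ennreal (indicator {0..<T} t * \<bar>d t s\<bar>))\<^sup>2 \<partial>lborel) =
          (\<integral>\<^sup>+t. ennreal (indicator {0..<T} t * (d t s)\<^sup>2) \<partial>lborel)"
        by (intro nn_integral_cong) (auto simp: ennreal_power indicator_def)
      also have "(\<integral>\<^sup>+t. (ennreal (C * indicator {0..<T} t))\<^sup>2 \<partial>lborel) = (\<integral>\<^sup>+t. ennreal (C\<^sup>2) * indicator {0..<T} t \<partial>lborel)"
        using \<open>C \<ge> 0\<close> by (intro nn_integral_cong) (auto simp: ennreal_power indicator_def)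
      also have "\<dots> = ennreal (C\<^sup>2 * T)"
        using T by (simp add: nn_integral_cmult_indicator ennreal_mult)
      finally show ?thesis .
    qed
    have "(\<integral>\<^sup>+s. ennreal ((fbm_K_volterra s - fbm_grid_sum n (\<lambda>t. volterra_kernel H t s))\<^sup>2) \<partial>lborel) \<le>
        (\<integral>\<^sup>+s. ennreal (C\<^sup>2 * T) * (\<integral>\<^sup>+t. ennreal (indicator {0..<T} t * (d t s)\<^sup>2) \<partial>lborel) \<partial>lborel)"
      by (intro nn_integral_mono pointwise)
    also have "\<dots> = ennreal (C\<^sup>2 * T) * (\<integral>\<^sup>+s. (\<integral>\<^sup>+t. ennreal (indicator {0..<T} t * (d t s)\<^sup>2) \<partial>lborel) \<partial>lborel)"
      by (intro nn_integral_cmult) measurable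
    also have "(\<integral>\<^sup>+s. (\<integral>\<^sup>+t. ennreal (indicator {0..<T} t * (d t s)\<^sup>2) \<partial>lborel) \<partial>lborel) =
        (\<integral>\<^sup>+t. (\<integral>\<^sup>+s. ennreal (indicator {0..<T} t * (d t s)\<^sup>2) \<partial>lborel) \<partial>lborel)"
      by (rule lborel_pair.Fubini') measurable
    also have "\<dots> \<le> (\<integral>\<^sup>+t. ennreal (4 * (T / real (Suc n)) powr (2 * H)) * indicator {0..<T} t \<partial>lborel)"
    proof (rule nn_integral_mono)
      fix t :: real
      show "(\<integral>\<^sup>+s. ennreal (indicator {0..<T} t * (d t s)\<^sup>2) \<partial>lborel) \<le>
          ennreal (4 * (T / real (Suc n)) powr (2 * H)) * indicator {0..<T} t"
      proof (cases "t \<in> {0..<T}")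
        case True
        note b = grid_floor_bounds[OF T zero_less_Suc True, of n]
        have "(\<integral>\<^sup>+s. ennreal ((d t s)\<^sup>2) \<partial>lborel) \<le> ennreal (4 * \<bar>grid_floor T (Suc n) t - t\<bar> powr (2 * H))"
          unfolding d_def using True b by (intro volterra_kernel_increment) auto
        also have "\<dots> \<le> ennreal (4 * (T / real (Suc n)) powr (2 * H))"
          using b H by (intro ennreal_leI mult_left_mono powr_mono2) auto
        finally show ?thesis using True by simp
      qed simp
    qed
    also have "\<dots> = ennreal (4 * (T / real (Suc n)) powr (2 * H) * T)"
      using T by (simp add: nn_integral_cmult_indicator ennreal_mult)
    also have "ennreal (C\<^sup>2 * T) * \<dots> = ennreal (A * (T / real (Suc n)) powr (2 * H))"
      using T by (subst ennreal_mult[symmetric]) (auto simp: A_def mult_ac)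
    finally show ?thesis by (simp add: mult_left_mono)
  qed
  moreover have "A \<ge> 0"
    using T by (simp add: A_def)
  ultimately show ?thesis by (rule that)
qed

lemma fbm_K_volterra_L2_approximation:
  obtains A where "L2_fun (lebesgue_on {0..T}) fbm_K_volterra" "A \<ge> 0"
    "\<And>n. (\<integral>s. (fbm_K_volterra s - fbm_grid_sum n (\<lambda>t. volterra_kernel H t s))\<^sup>2 \<partial>lebesgue_on {0..T})
      \<le> A * (T / real (Suc n)) powr (2 * H)"
proof -
  obtain A where A: "\<And>n. (\<integral>\<^sup>+s. ennreal ((fbm_K_volterra s - fbm_grid_sum n (\<lambda>t. volterra_kernel H t s))\<^sup>2) \<partial>lborel)
      \<le> ennreal (A * (T / real (Suc n)) powr (2 * H))" "A \<ge> 0"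
    using fbm_K_volterra_approximation by blast
  define D where "D n s = fbm_K_volterra s - fbm_grid_sum n (\<lambda>t. volterra_kernel H t s)" for n s
  note fbm_K_volterra_measurable [measurable]
  have [measurable]: "D n \<in> borel_measurable borel" for n
    unfolding D_def fbm_grid_sum_def by measurable
  have D0: "(D n s)\<^sup>2 = 0" if "s \<notin> {0..T}" for n s
  proof -
    have "volterra_kernel H (grid n i) s = 0" if "i < Suc n" for i
      using grid_mem[OF that] \<open>s \<notin> {0..T}\<close> by (intro volterra_kernel_eq_0) auto
    then have "(\<Sum>i<Suc n. (f (grid n (Suc i)) - f (grid n i)) * volterra_kernel H (grid n i) s) = 0"
      by (intro sum.neutral) auto
    with that show ?thesis
      by (auto simp: D_def fbm_grid_sum_def fbm_K_volterra_eq_0 volterra_kernel_eq_0 simp del: sum.lessThan_Suc)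
  qed
  have int: "integrable lborel (\<lambda>s. (D n s)\<^sup>2)" for n
  proof (rule integrableI_bounded)
    show "(\<integral>\<^sup>+s. ennreal (norm ((D n s)\<^sup>2)) \<partial>lborel) < \<infinity>"
      using le_less_trans[OF A(1)[of n] ennreal_less_top] by (simp add: D_def)
  qed measurable
  have bound: "(\<integral>s. (D n s)\<^sup>2 \<partial>lebesgue_on {0..T}) \<le> A * (T / real (Suc n)) powr (2 * H)" for n
  proof -
    have "ennreal (\<integral>s. (D n s)\<^sup>2 \<partial>lborel) \<le> ennreal (A * (T / real (Suc n)) powr (2 * H))"
      using A(1)[of n] nn_integral_eq_integral[OF int[of n]] by (simp add: D_def)
    then have "(\<integral>s. (D n s)\<^sup>2 \<partial>lborel) \<le> A * (T / real (Suc n)) powr (2 * H)"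
      using A(2) by (subst (asm) ennreal_le_iff) auto
    then show ?thesis
      by (subst integral_lebesgue_on_eq_lborel) (auto simp: D0)
  qed
  have "integrable (lebesgue_on {0..T}) (\<lambda>s. (D 0 s)\<^sup>2)"
    by (subst integrable_lebesgue_on_iff_lborel) (auto simp: D0 int)
  moreover have "D 0 \<in> borel_measurable (lebesgue_on {0..T})"
    by (intro measurable_restrict_space1 measurable_completion) measurable
  ultimately have "L2_fun (lebesgue_on {0..T}) (D 0)"
    by (simp add: L2_fun_def)
  \<comment> \<open>\<open>fbm_K_volterra\<close> is the error \<open>D 0\<close> plus the grid sum
    on a single cell, both square integrable.\<close>
  from L2_fun_add[OF this has_wiener_integral_L2(1)[OF has_wiener_integral_fbm_grid_sum[of 0]]]
  have "L2_fun (lebesgue_on {0..T}) fbm_K_volterra"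
    by (simp add: D_def[abs_def])
  then show ?thesis
    using that[OF _ A(2)] bound by (simp add: D_def)
qed

text \<open>The grid sums \<open>Y n\<close> are read in two ways: as Wiener integrals of
  \<open>k n\<close>, which gives the Cauchy property in mean square, and as sums along each
  continuous path, which gives the almost sure limit.\<close>

lemma has_wiener_integral_fbm_K:
  obtains Z where "has_wiener_integral M B T (fbm_K H T f) Z"
    "AE \<omega> in M. Z \<omega> = BH T \<omega> * f T - integral {0..T} (\<lambda>t. BH t \<omega> * f' t)"
proof -
  obtain A where L2: "L2_fun (lebesgue_on {0..T}) fbm_K_volterra" and A: "A \<ge> 0"
    "\<And>n. (\<integral>s. (fbm_K_volterra s - fbm_grid_sum n (\<lambda>t. volterra_kernel H t s))\<^sup>2 \<partial>lebesgue_on {0..T})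
      \<le> A * (T / real (Suc n)) powr (2 * H)"
    using fbm_K_volterra_L2_approximation by blast
  define b where "b n = A * (T / real (Suc n)) powr (2 * H)" for n
  have "(\<lambda>n. (T / real (Suc n)) powr (2 * H)) \<longlonglongrightarrow> 0"
    using H T by (intro tendsto_zero_powrI[OF LIMSEQ_mesh tendsto_const]) auto
  then have b_lim: "b \<longlonglongrightarrow> 0"
    unfolding b_def using tendsto_mult[OF tendsto_const] by fastforce
  have b_anti: "b m \<le> b n" if "n \<le> m" for m n
    unfolding b_def using that A(1) T H by (intro mult_left_mono powr_mono2 divide_left_mono) auto
  define k where "k n s = fbm_grid_sum n (\<lambda>t. volterra_kernel H t s)" for n s
  define Y where "Y n \<omega> = fbm_grid_sum n (\<lambda>t. BH t \<omega>)" for n \<omega>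
  \<comment> \<open>Taking \<open>lim\<close> at every point makes \<open>Z\<close> measurable at
    once; only almost everywhere does it have to equal the pathwise expression.\<close>
  define Z where "Z \<omega> = lim (\<lambda>n. Y n \<omega>)" for \<omega>
  have wi: "has_wiener_integral M B T (k n) (Y n)" for n
    unfolding k_def Y_def by (rule has_wiener_integral_fbm_grid_sum)
  note L2_k = has_wiener_integral_L2(1)[OF wi] and L2_Y = has_wiener_integral_L2(2)[OF wi]
  have Y_lim: "AE \<omega> in M. (\<lambda>n. Y n \<omega>) \<longlonglongrightarrow> BH T \<omega> * f T - integral {0..T} (\<lambda>t. BH t \<omega> * f' t)"
  proof -
    have "AE \<omega> in M. continuous_on {0..T} (\<lambda>t. BH t \<omega>)"
      using fbm by (simp add: fractional_brownian_motion_def continuous_paths_def)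
    then show ?thesis
    proof eventually_elim
      case (elim \<omega>)
      have "(\<lambda>n. f T * BH T \<omega> -
          (\<Sum>i<Suc n. (f (T * real (Suc i) / real (Suc n)) - f (T * real i / real (Suc n))) * BH (T * real i / real (Suc n)) \<omega>))
          \<longlonglongrightarrow> f T * BH T \<omega> - integral {0..T} (\<lambda>t. BH t \<omega> * f' t)"
        by (intro tendsto_diff tendsto_const grid_sum_tendsto[OF T f f' elim])
      then show ?case
        by (simp only: Y_def fbm_grid_sum_def grid_def mult.commute[of "f T"])
    qed
  qed
  then have Z_eq: "AE \<omega> in M. Z \<omega> = BH T \<omega> * f T - integral {0..T} (\<lambda>t. BH t \<omega> * f' t)"
    by eventually_elim (simp add: Z_def limI)
  have Y_Z: "AE \<omega> in M. (\<lambda>n. Y n \<omega>) \<longlonglongrightarrow> Z \<omega>"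
    using Y_lim Z_eq by eventually_elim simp
  have Z_meas: "Z \<in> borel_measurable M"
    unfolding Z_def using L2_Y by (intro borel_measurable_lim_metric) (simp add: L2_fun_def)
  \<comment> \<open>The constant is \<open>4 * (2 + 2)\<close>: the isometry bound times the
    splitting of \<open>k m - k n\<close> at \<open>fbm_K_volterra\<close>, with
    \<open>b m \<le> b n\<close>.\<close>
  have cauchy: "(\<integral>\<omega>. (Y m \<omega> - Y n \<omega>)\<^sup>2 \<partial>M) \<le> 16 * b n" if "n \<le> m" for m n
  proof -
    have "has_wiener_integral M B T (\<lambda>s. 1 * k m s + (-1) * k n s) (\<lambda>\<omega>. 1 * Y m \<omega> + (-1) * Y n \<omega>)"
      by (intro has_wiener_integral_linear wiener_B wi)
    then have "has_wiener_integral M B T (\<lambda>s. k m s - k n s) (\<lambda>\<omega>. Y m \<omega> - Y n \<omega>)"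
      by simp
    from has_wiener_integral_bounds(1)[OF wiener_B this]
    have "(\<integral>\<omega>. (Y m \<omega> - Y n \<omega>)\<^sup>2 \<partial>M) \<le> 4 * (\<integral>s. (k m s - k n s)\<^sup>2 \<partial>lebesgue_on {0..T})" .
    moreover have "(\<integral>s. (k m s - k n s)\<^sup>2 \<partial>lebesgue_on {0..T}) \<le> 2 * b m + 2 * b n"
      using integral_sq_diff_le[OF L2_k[of m] L2 L2_k[of n]] A(2)[of m] A(2)[of n]
      by (simp only: power2_commute[of "k m _" "fbm_K_volterra _"]) (simp add: k_def b_def del: of_nat_Suc)
    ultimately show ?thesis
      using b_anti[OF that] by linarith
  qed
  have "has_wiener_integral M B T fbm_K_volterra Z"
  proof (rule has_wiener_integral_limit[OF wiener_B L2 _ wi])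
    show "L2_fun M Z"
      by (rule L2_fun_limit(1)[OF L2_Y Z_meas Y_Z cauchy])
    show "(\<lambda>n. \<integral>s. (fbm_K_volterra s - k n s)\<^sup>2 \<partial>lebesgue_on {0..T}) \<longlonglongrightarrow> 0"
      by (rule tendsto_sandwich[OF _ _ tendsto_const b_lim])
        (use A(2) in \<open>auto simp: k_def b_def intro!: always_eventually simp del: of_nat_Suc\<close>)
    show "(\<lambda>n. \<integral>\<omega>. (Z \<omega> - Y n \<omega>)\<^sup>2 \<partial>M) \<longlonglongrightarrow> 0"
    proof (rule tendsto_sandwich[OF _ _ tendsto_const])
      show "\<forall>\<^sub>F n in sequentially. (\<integral>\<omega>. (Z \<omega> - Y n \<omega>)\<^sup>2 \<partial>M) \<le> 16 * b n"
        by (intro always_eventually allI L2_fun_limit(2)[OF L2_Y Z_meas Y_Z cauchy])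
      show "(\<lambda>n. 16 * b n) \<longlonglongrightarrow> 0"
        using tendsto_mult[OF tendsto_const b_lim, of 16] by simp
    qed (auto intro!: always_eventually)
  qed
  then have "has_wiener_integral M B T (fbm_K H T f) Z"
    by (rule has_wiener_integral_cong[where X="{0, T}"]) (auto simp: fbm_K_eq_volterra)
  then show ?thesis
    using that Z_eq by blast
qed

text \<open>The preimage is \<open>fbm_K H T f\<close>, square integrable because it has a Wiener
  integral.\<close>

lemma fbm_integrand_f: "fbm_integrand H T f"
  unfolding fbm_integrand_def
proof (intro exI conjI)
  show "L2_fun (lebesgue_on {0..T}) (fbm_K H T f)"
    by (rule has_wiener_integral_fbm_K) (rule has_wiener_integral_L2(1))
  have "AE t in lebesgue. t \<noteq> 0 \<and> t \<noteq> T"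
    using AE_lborel_singleton[of 0] AE_lborel_singleton[of T] by (intro AE_completion) auto
  then have "AE t in lebesgue. t \<in> {0..T} \<longrightarrow> f t = fbm_K_star H T (fbm_K H T f) t"
  proof eventually_elim
    case (elim t)
    then show ?case
      using fbm_K_star_fbm_K[OF H refl T f f', of t] by auto
  qed
  then show "AE t in lebesgue_on {0..T}. f t = fbm_K_star H T (fbm_K H T f) t"
    by (simp add: AE_restrict_space_iff)
qed

end

end

theorem lemma2p3:
  fixes M :: "'a measure" and H T :: real
    and BH B :: "real \<Rightarrow> 'a \<Rightarrow> real" and f f' :: "real \<Rightarrow> real"
  assumes "0 < H" "H < 1/2" "0 < T"
    and "fractional_brownian_motion M H {0..T} BH"
    and "underlying_wiener_process M H T BH B"
    and "\<And>t. t \<in> {0..T} \<Longrightarrow> (f has_real_derivative f' t) (at t within {0..T})"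
    and "continuous_on {0..T} f'"
  shows "fbm_integrand H T f \<and>
    (AE \<omega> in M. rs_integrable (\<lambda>t. BH t \<omega>) f 0 T \<and>
       fbm_wiener_integral M H B T f \<omega> =
         BH T \<omega> * f T - rs_integral (\<lambda>t. BH t \<omega>) f 0 T)"
proof
  show "fbm_integrand H T f"
    using assms by (rule fbm_integrand_f)
  obtain Z where Z: "has_wiener_integral M B T (fbm_K H T f) Z"
    "AE \<omega> in M. Z \<omega> = BH T \<omega> * f T - integral {0..T} (\<lambda>t. BH t \<omega> * f' t)"
    using has_wiener_integral_fbm_K[OF assms] by blast
  \<comment> \<open>Existence of \<open>Z\<close> makes the chosen version a genuine integral;
    uniqueness then identifies it with \<open>Z\<close> almost surely.\<close>
  from Z(1) have "has_wiener_integral M B T (fbm_K H T f) (fbm_wiener_integral M H B T f)"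
    unfolding fbm_wiener_integral_def wiener_integral_def
    by (rule someI[of "has_wiener_integral M B T (fbm_K H T f)"])
  from has_wiener_integral_unique[OF wiener_B[OF assms(1-5)] this Z(1)] Z(2)
  have "AE \<omega> in M. fbm_wiener_integral M H B T f \<omega> =
      BH T \<omega> * f T - integral {0..T} (\<lambda>t. BH t \<omega> * f' t)"
    by eventually_elim simp
  moreover have "AE \<omega> in M. continuous_on {0..T} (\<lambda>t. BH t \<omega>)"
    using assms(4) by (simp add: fractional_brownian_motion_def continuous_paths_def)
  ultimately show "AE \<omega> in M. rs_integrable (\<lambda>t. BH t \<omega>) f 0 T \<and>
       fbm_wiener_integral M H B T f \<omega> =
         BH T \<omega> * f T - rs_integral (\<lambda>t. BH t \<omega>) f 0 T"
  proof eventually_elim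
    case (elim \<omega>)
    have "has_rs_integral (\<lambda>t. BH t \<omega>) f 0 T (integral {0..T} (\<lambda>t. BH t \<omega> * f' t))"
      by (rule has_rs_integral_C1[OF assms(3,6,7) elim(2)])
    then show ?case
      using elim(1) by (auto simp: rs_integrable_def rs_integral_eq)
  qed
qed

end
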